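(* Let $X,Y$ be sets and let $a$ be a partial function from $Y$ to $X$. Let $\operatorname{im}(a)=\{a_i:i\in I\}$ (with $i\mapsto a_i$ injective), $\lambda_i=|a_ia^{-1}|$ for $i\in I$, $\Lambda_I=\prod_{i\in I}\lambda_i$, $\alpha=\operatorname{rank}(a)=|I|$ and $\beta=|X\setminus\operatorname{im}(a)|$. Let $P^a=\operatorname{Reg}(\mathcal{PT}_{XY}^a)$, a semigroup under $\star_a$. (i) If $|P^a|\geq\aleph_0$, then $\operatorname{rank}(P^a)=|P^a|$. (ii) If $|P^a|<\aleph_0$ (so that $\alpha=0$ or [$|X|<\aleph_0$ and $\lambda_i<\aleph_0$ for all $i\in I$]), then $$\operatorname{rank}(P^a)=\begin{cases}1&\text{if }\alpha=0\\ 1+\max(2^\beta,\Lambda_I)&\text{if }\alpha=1\\ 2+\max(3^\beta,\Lambda_I)&\text{if }\alpha=2\\ 2+\max((\alpha+1)^\beta,\Lambda_I,2)&\text{if }\alpha\geq3.\end{cases}$$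
   Context: Maps are written on the right and composed left to right. $\mathcal{PT}_{XY}$ is the set of all partial functions $X\to Y$; $\mathcal{PT}_{XY}^a$ is the sandwich semigroup $(\mathcal{PT}_{XY},\star_a)$ with $f\star_ag=fag$; $\operatorname{Reg}(\mathcal{PT}_{XY}^a)$ is the set of its regular elements, i.e. those $f$ with $f=f\star_ag\star_af$ for some $g\in\mathcal{PT}_{XY}$; it is a subsemigroup. For a partial function, $\operatorname{rank}(a)=|\operatorname{im}(a)|$; for a semigroup $T$, $\operatorname{rank}(T)$ is the least cardinality of a generating set (generation as a semigroup). *)

theory Defs
  imports Main
begin

unbundle cardinal_syntax

definition PT :: "'x set \<Rightarrow> 'y set \<Rightarrow> ('x \<rightharpoonup> 'y) set" where
  "PT X Y = {f. dom f \<subseteq> X \<and> ran f \<subseteq> Y}"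

text \<open>
  In the source maps act on the right, so the product \<open>f a g\<close> applies \<open>f\<close> first and \<open>g\<close> last.
\<close>

definition sandwich :: "('y \<rightharpoonup> 'x) \<Rightarrow> ('x \<rightharpoonup> 'y) \<Rightarrow> ('x \<rightharpoonup> 'y) \<Rightarrow> ('x \<rightharpoonup> 'y)" where
  "sandwich a f g = g \<circ>\<^sub>m (a \<circ>\<^sub>m f)"

definition RegPT :: "'x set \<Rightarrow> 'y set \<Rightarrow> ('y \<rightharpoonup> 'x) \<Rightarrow> ('x \<rightharpoonup> 'y) set" where
  "RegPT X Y a = {f \<in> PT X Y. \<exists>g \<in> PT X Y. f = sandwich a (sandwich a f g) f}"

inductive_set sgp_gen :: "('s \<Rightarrow> 's \<Rightarrow> 's) \<Rightarrow> 's set \<Rightarrow> 's set"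
  for m :: "'s \<Rightarrow> 's \<Rightarrow> 's" and A :: "'s set"
where
  incl: "x \<in> A \<Longrightarrow> x \<in> sgp_gen m A"
| mult: "x \<in> sgp_gen m A \<Longrightarrow> y \<in> sgp_gen m A \<Longrightarrow> m x y \<in> sgp_gen m A"

definition generating_sets :: "'s set \<Rightarrow> ('s \<Rightarrow> 's \<Rightarrow> 's) \<Rightarrow> 's set set" where
  "generating_sets S m = {A. A \<subseteq> S \<and> sgp_gen m A = S}"

text \<open>
  The rank is a possibly infinite cardinal, so it is a cardinal order in the sense of the
  cardinals library and is determined only up to \<open>=o\<close>.
\<close>

definition sgp_rank :: "'s set \<Rightarrow> ('s \<Rightarrow> 's \<Rightarrow> 's) \<Rightarrow> 's rel" where
  "sgp_rank S m =
    (SOME r. r \<in> card_of ` generating_sets S m \<and> (\<forall>r' \<in> card_of ` generating_sets S m. r \<le>o r'))"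

end

theory Submission
  imports Defs "HOL-Combinatorics.Cycles"
begin

text \<open>
  Put \<open>A = ran a\<close>. An element is regular iff it factors as a partial retraction
  \<open>r\<close> of \<open>X\<close> onto \<open>A\<close>, followed by a partial self-map \<open>t\<close> (its core) of \<open>A\<close>, followed by a
  section \<open>c\<close> of \<open>a\<close>; the sandwich product of \<open>(r, t, c)\<close> and \<open>(r', t', c')\<close> is
  \<open>(r, t t', c')\<close>, with \<open>t t'\<close> meaning first \<open>t\<close>, then \<open>t'\<close>. When \<open>A\<close> is finite, the elements
  with invertible core form a rectangular group whose complement is an ideal, so generators with
  invertible core must realise every retraction (there are \<open>(\<alpha> + 1) ^ \<beta>\<close> of them), every section
  (there are \<open>Lam\<close>) and generate the symmetric group on \<open>A\<close>; conversely that many suffice for the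
  rectangular group. Beyond it one needs, and it is enough to add, one element whose core is
  injective and undefined at a single point and, if \<open>\<alpha> \<ge> 2\<close>, one whose core is total and not
  injective. If the semigroup is infinite it is not finitely generated: either \<open>A\<close> is infinite and
  there are uncountably many partial identities, or there are infinitely many retractions or sections.
\<close>

subsection \<open>Generated subsemigroups and the symmetric group\<close>

lemma sgp_gen_closed:
  assumes "A \<subseteq> S" and "\<And>x y. x \<in> S \<Longrightarrow> y \<in> S \<Longrightarrow> m x y \<in> S"
  shows "sgp_gen m A \<subseteq> S"
proof
  fix x assume "x \<in> sgp_gen m A"
  then show "x \<in> S" by induction (use assms in auto)
qed

lemma sgp_gen_mono: "A \<subseteq> B \<Longrightarrow> sgp_gen m A \<subseteq> sgp_gen m B"
  by (rule sgp_gen_closed) (auto intro: sgp_gen.intros)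

text \<open>A monogenic semigroup consists of powers of \<open>s\<close>: each element commutes with
  \<open>s\<close>, hence with every product of copies of \<open>s\<close>. This later rules out a
  single generator for a noncommutative group of units.\<close>

lemma sgp_gen_singleton_commute:
  assumes assoc: "\<And>x y z. m (m x y) z = m x (m y z)"
    and "x \<in> sgp_gen m {s}" and "y \<in> sgp_gen m {s}"
  shows "m x y = m y x"
proof -
  have s: "m z s = m s z" if "z \<in> sgp_gen m {s}" for z
    using that
  proof induction
    case (mult x y)
    then show ?case by (metis assoc)
  qed auto
  show ?thesis
    using assms(3)
  proof induction
    case (incl y)
    then show ?case using s[OF assms(2)] by auto
  next
    case (mult y z)
    then show ?case by (metis assoc)
  qed
qed

lemma funpow_sgp_gen: "p \<in> sgp_gen (\<circ>) A \<Longrightarrow> p ^^ Suc n \<in> sgp_gen (\<circ>) A"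
proof (induction n)
  case (Suc n)
  then have "p \<circ> p ^^ Suc n \<in> sgp_gen (\<circ>) A" by (blast intro: sgp_gen.mult)
  then show ?case by (simp only: funpow.simps)
qed simp

text \<open>A permutation of a finite set has finite order, so its identity and inverse are positive
  powers and semigroup generation loses nothing against group generation. Taking the exponent above
  1 keeps \<open>n - 1\<close> positive.\<close>

lemma permutes_sgp_gen_id_inv:
  assumes "finite A" and "p permutes A" and "p \<in> sgp_gen (\<circ>) B"
  shows "id \<in> sgp_gen (\<circ>) B" and "inv p \<in> sgp_gen (\<circ>) B"
proof -
  obtain n where n: "p ^^ n = id" "n > 1"
    using permutation_is_nilpotent' assms permutation_permutes by metis
  define k where "k = n - 2"
  have k: "n = Suc (Suc k)" using n by (simp add: k_def)
  show "id \<in> sgp_gen (\<circ>) B" using funpow_sgp_gen[OF assms(3), of "Suc k"] n k by simp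
  have "p \<circ> p ^^ Suc k = id" using n k funpow.simps(2)[of "Suc k" p] by metis
  moreover have "p ^^ Suc k \<circ> p = id" using n k funpow_Suc_right[of "Suc k" p] by metis
  ultimately have "inv p = p ^^ Suc k" by (rule inv_unique_comp)
  then show "inv p \<in> sgp_gen (\<circ>) B" using funpow_sgp_gen[OF assms(3)] by simp
qed

text \<open>The generators are a full cycle and a transposition of two neighbours on it. The clause
  on small sets is what permits a single generator with invertible core when \<alpha> is at most
  2.\<close>

lemma symmetric_two_generators:
  assumes "finite A"
  shows "\<exists>p q. p permutes A \<and> q permutes A \<and> (card A \<le> 2 \<longrightarrow> p = q) \<and>
    {r. r permutes A} \<subseteq> sgp_gen (\<circ>) {p, q}"
proof (cases "card A \<le> 1")
  case True
  have "r = id" if "r permutes A" for r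
  proof
    fix x
    show "r x = id x"
    proof (cases "x \<in> A")
      case True
      have "A = {x}"
        using \<open>card A \<le> 1\<close> True assms card_le_Suc0_iff_eq by fastforce
      then show ?thesis using permutes_in_image[OF that, of x] by simp
    next
      case False
      then show ?thesis using permutes_not_in[OF that] by simp
    qed
  qed
  then have "{r. r permutes A} \<subseteq> sgp_gen (\<circ>) {id}" by (auto intro: sgp_gen.incl)
  then show ?thesis by (intro exI[of _ id]) (auto simp: permutes_id)
next
  case False
  define n where "n = card A"
  obtain e where e: "bij_betw e {0..<n} A" using ex_bij_betw_nat_finite assms n_def by blast
  have n: "n \<ge> 2" using False n_def by simp
  have inj: "e i = e j \<longleftrightarrow> i = j" if "i < n" "j < n" for i j
    using e that by (auto simp: bij_betw_def inj_on_def)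
  have eA: "e i \<in> A" if "i < n" for i using e that by (auto simp: bij_betw_def)
  have Ae: "\<exists>i<n. x = e i" if "x \<in> A" for x using e that by (force simp: bij_betw_def)
  \<comment> \<open>\<open>s\<close> is the cycle \<open>e 0\<close>, \<open>e 1\<close>, ...,
    \<open>e (n - 1)\<close> back to \<open>e 0\<close>; \<open>t\<close> swaps its first two
    points.\<close>
  define s where "s x = (if x \<in> A then e (Suc (inv_into {0..<n} e x) mod n) else x)" for x
  define t where "t = transpose (e 0) (e 1)"
  have s_e: "s (e i) = e (Suc i mod n)" if "i < n" for i
    using that eA e by (simp add: s_def bij_betw_inv_into_left)
  have "A \<subseteq> s ` A"
  proof
    fix x assume "x \<in> A"
    then obtain i where i: "i < n" "x = e i" using Ae by blast
    show "x \<in> s ` A"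
    proof (cases i)
      case 0
      then have "x = s (e (n - 1))" using i n by (simp add: s_e)
      then show ?thesis using eA[of "n - 1"] n by simp
    next
      case (Suc k)
      then have "x = s (e k)" using i by (simp add: s_e)
      then show ?thesis using eA[of k] i Suc by simp
    qed
  qed
  moreover have "s ` A \<subseteq> A" using n eA by (auto simp: s_def)
  ultimately have "bij_betw s A A"
    using finite_surj_inj[OF assms, of s] by (auto simp: bij_betw_def)
  then have s_perm: "s permutes A" by (rule bij_imp_permutes) (simp add: s_def)
  have t_perm: "t permutes A" using eA n by (auto simp: t_def intro: permutes_swap_id)
  define H where "H = sgp_gen (\<circ>) {s, t}"
  have "s \<in> H" "t \<in> H" unfolding H_def by (auto intro: sgp_gen.incl)
  have comp: "p \<circ> q \<in> H" if "p \<in> H" "q \<in> H" for p q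
    using that unfolding H_def by (rule sgp_gen.mult)
  have inv: "id \<in> H" "inv s \<in> H"
    using permutes_sgp_gen_id_inv[OF assms s_perm] \<open>s \<in> H\<close> unfolding H_def by blast+
  \<comment> \<open>Conjugation by \<open>s\<close> moves the swap of two neighbours one place along
    the cycle.\<close>
  have adj: "transpose (e i) (e (Suc i)) \<in> H" if "Suc i < n" for i
    using that
  proof (induction i)
    case 0
    then show ?case using \<open>t \<in> H\<close> by (simp add: t_def)
  next
    case (Suc i)
    have "bij s" using s_perm permutes_bij by blast
    have "transpose (s (e i)) (s (e (Suc i))) \<circ> s = s \<circ> transpose (e i) (e (Suc i))"
      using transpose_comp_eq[OF \<open>bij s\<close>] \<open>bij s\<close> by (simp add: bij_is_inj)
    then have "transpose (s (e i)) (s (e (Suc i))) = s \<circ> transpose (e i) (e (Suc i)) \<circ> inv s"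
      using \<open>bij s\<close> by (metis bij_is_surj comp_assoc comp_id surj_iff)
    moreover have "s \<circ> transpose (e i) (e (Suc i)) \<circ> inv s \<in> H"
      using Suc inv \<open>s \<in> H\<close> by (intro comp) auto
    moreover have "s (e i) = e (Suc i)" "s (e (Suc i)) = e (Suc (Suc i))"
      using Suc.prems by (simp_all add: s_e)
    ultimately show ?case by metis
  qed
  \<comment> \<open>Conjugating the swap of \<open>e i\<close> and \<open>e (Suc i)\<close> by that
    of \<open>e 0\<close> and \<open>e i\<close> gives the swap of \<open>e 0\<close> and
    \<open>e (Suc i)\<close>. The same trick through \<open>e 0\<close> then yields all
    transpositions.\<close>
  have star: "transpose (e 0) (e i) \<in> H" if "i < n" for i
    using that
  proof (induction i)
    case 0
    then show ?case using inv by (simp only: transpose_same)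
  next
    case (Suc i)
    show ?case
    proof (cases i)
      case 0
      then show ?thesis using \<open>t \<in> H\<close> by (simp add: t_def)
    next
      case (Suc j)
      have "transpose (e 0) (e i) \<circ> transpose (e i) (e (Suc i)) \<circ> transpose (e 0) (e i) \<in> H"
        using Suc.IH Suc.prems adj by (intro comp) auto
      then show ?thesis
        using Suc.prems Suc inj by (subst (asm) transpose_comp_triple) auto
    qed
  qed
  have all: "transpose x y \<in> H" if "x \<in> A" "y \<in> A" for x y
  proof -
    obtain i where i: "i < n" "x = e i" using Ae[OF \<open>x \<in> A\<close>] by blast
    obtain j where j: "j < n" "y = e j" using Ae[OF \<open>y \<in> A\<close>] by blast
    note ij = i j
    show ?thesis
    proof (cases "i = 0 \<or> j = 0 \<or> i = j")
      case True
      then show ?thesis using ij star inv by (metis transpose_commute transpose_same)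
    next
      case False
      have "transpose x (e 0) \<in> H" "transpose (e 0) y \<in> H"
        using star ij transpose_commute by metis+
      then have "transpose x (e 0) \<circ> transpose (e 0) y \<circ> transpose x (e 0) \<in> H"
        by (intro comp)
      then show ?thesis
        using False ij inj n by (subst (asm) transpose_comp_triple) auto
    qed
  qed
  have "r \<in> H" if "r permutes A" for r
    using that assms
  proof (induction rule: permutes_induct)
    case id
    show ?case by (rule inv)
  next
    case (swap a b p)
    then show ?case using all by (intro comp) auto
  qed
  moreover have "s = t" if "n \<le> 2"
  proof
    fix x
    show "s x = t x"
    proof (cases "x \<in> A")
      case True
      then obtain i where i: "i < n" "x = e i" using Ae by blast
      then have "i = 0 \<or> i = 1" using that by linarith
      then show ?thesis using i n that s_e[of i] by (auto simp: t_def)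
    next
      case False
      then show ?thesis using s_perm t_perm permutes_not_in by metis
    qed
  qed
  ultimately show ?thesis using s_perm t_perm unfolding n_def H_def by blast
qed

subsection \<open>Partial self-maps of a finite set\<close>

lemma map_comp_assoc: "(f \<circ>\<^sub>m g) \<circ>\<^sub>m h = f \<circ>\<^sub>m (g \<circ>\<^sub>m h)"
  by (rule ext) (simp add: map_comp_def split: option.splits)

lemma PT_iff: "f \<in> PT A B \<longleftrightarrow> (\<forall>x y. f x = Some y \<longrightarrow> x \<in> A \<and> y \<in> B)"
  by (auto simp: PT_def ran_def)

lemma PT_comp: "f \<in> PT A B \<Longrightarrow> g \<in> PT B C \<Longrightarrow> g \<circ>\<^sub>m f \<in> PT A C"
  by (auto simp: PT_iff map_comp_Some_iff)

lemma finite_PT: "finite A \<Longrightarrow> finite B \<Longrightarrow> finite (PT A B)"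
proof -
  assume fin: "finite A" "finite B"
  have "PT A B \<subseteq> (\<Union>D\<in>Pow A. {f. dom f = D \<and> ran f \<subseteq> B})" by (auto simp: PT_def)
  moreover have "finite (\<Union>D\<in>Pow A. {f. dom f = D \<and> ran f \<subseteq> B})"
    using fin by (auto intro: finite_set_of_finite_maps finite_subset)
  ultimately show ?thesis by (rule finite_subset)
qed

definition idp :: "'a set \<Rightarrow> 'a \<rightharpoonup> 'a" where
  "idp A = Some |` A"

lemma idp_apply [simp]: "idp A x = (if x \<in> A then Some x else None)"
  by (simp add: idp_def restrict_map_def)

lemma dom_idp [simp]: "dom (idp A) = A"
  by (auto simp: dom_def)

lemma idp_PT: "idp A \<in> PT A A"
  by (simp add: PT_iff)

lemma idp_comp_left: "f \<in> PT A B \<Longrightarrow> idp B \<circ>\<^sub>m f = f"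
  by (rule ext) (auto simp: PT_iff map_comp_def split: option.splits)

lemma idp_comp_right: "f \<in> PT A B \<Longrightarrow> f \<circ>\<^sub>m idp A = f"
  by (rule ext) (auto simp: PT_iff map_comp_def, metis option.exhaust)

section \<open>The group of units of the monoid of partial self-maps\<close>

definition units :: "'a set \<Rightarrow> ('a \<rightharpoonup> 'a) set" where
  "units A = {t \<in> PT A A. \<exists>s \<in> PT A A. s \<circ>\<^sub>m t = idp A \<and> t \<circ>\<^sub>m s = idp A}"

lemma units_PT: "t \<in> units A \<Longrightarrow> t \<in> PT A A"
  by (simp add: units_def)

lemma idp_units: "idp A \<in> units A"
  using idp_PT idp_comp_left[OF idp_PT] by (auto simp: units_def)

lemma units_inverse:
  assumes "t \<in> units A"
  obtains s where "s \<in> units A" "s \<circ>\<^sub>m t = idp A" "t \<circ>\<^sub>m s = idp A"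
  using assms by (auto simp: units_def)

lemma units_comp:
  assumes "t \<in> units A" "u \<in> units A"
  shows "t \<circ>\<^sub>m u \<in> units A"
proof -
  obtain t' where t': "t' \<in> units A" "t' \<circ>\<^sub>m t = idp A" "t \<circ>\<^sub>m t' = idp A"
    using assms units_inverse by blast
  obtain u' where u': "u' \<in> units A" "u' \<circ>\<^sub>m u = idp A" "u \<circ>\<^sub>m u' = idp A"
    using assms units_inverse by blast
  note pt = assms[THEN units_PT] t'(1)[THEN units_PT] u'(1)[THEN units_PT]
  have "(u' \<circ>\<^sub>m t') \<circ>\<^sub>m (t \<circ>\<^sub>m u) = idp A" "(t \<circ>\<^sub>m u) \<circ>\<^sub>m (u' \<circ>\<^sub>m t') = idp A"
    using t' u' pt by (metis map_comp_assoc idp_comp_right)+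
  then show ?thesis using pt PT_comp unfolding units_def by blast
qed

text \<open>A left inverse makes \<open>t\<close> total and injective on \<open>A\<close>;
  finiteness makes it onto, so the left inverse is two-sided.\<close>

lemma left_invertible_imp_units:
  assumes "finite A" "t \<in> PT A A" "u \<in> PT A A" "u \<circ>\<^sub>m t = idp A"
  shows "t \<in> units A" and "u \<in> units A"
proof -
  have ut: "\<exists>y. t x = Some y \<and> u y = Some x" if "x \<in> A" for x
    using fun_cong[OF assms(4), of x] that by (simp add: map_comp_Some_iff)
  have tA: "t x = Some y \<Longrightarrow> x \<in> A \<and> y \<in> A" for x y using assms(2) by (simp add: PT_iff)
  have "inj_on (\<lambda>x. the (t x)) A" by (rule inj_onI) (metis ut option.sel)
  moreover have "(\<lambda>x. the (t x)) ` A \<subseteq> A" using ut tA by force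
  ultimately have "(\<lambda>x. the (t x)) ` A = A" using assms(1) endo_inj_surj by blast
  then have surj: "\<exists>x\<in>A. t x = Some y" if "y \<in> A" for y using that ut by force
  have "(t \<circ>\<^sub>m u) y = idp A y" for y
  proof (cases "y \<in> A")
    case True
    then obtain x where "x \<in> A" "t x = Some y" using surj by blast
    then show ?thesis using ut True by (fastforce simp: map_comp_Some_iff)
  next
    case False
    then have "u y = None" using assms(3) by (metis PT_iff option.exhaust)
    then show ?thesis using False by (simp add: map_comp_None_iff)
  qed
  then have "t \<circ>\<^sub>m u = idp A" by blast
  then show "t \<in> units A" "u \<in> units A" using assms unfolding units_def by blast+
qed

text \<open>If \<open>s\<close> inverts the product, then \<open>s \<circ>\<^sub>m u\<close> is a
  left inverse of \<open>t\<close> and \<open>t \<circ>\<^sub>m s\<close> is a right inverse of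
  \<open>u\<close>. Thus the non-units form an ideal.\<close>

lemma comp_units_imp_units:
  assumes "finite A" "t \<in> PT A A" "u \<in> PT A A" "u \<circ>\<^sub>m t \<in> units A"
  shows "t \<in> units A" and "u \<in> units A"
proof -
  obtain s where s: "s \<in> units A" "s \<circ>\<^sub>m (u \<circ>\<^sub>m t) = idp A" "(u \<circ>\<^sub>m t) \<circ>\<^sub>m s = idp A"
    using assms(4) units_inverse by blast
  note s_PT = units_PT[OF s(1)]
  show "t \<in> units A"
    using left_invertible_imp_units(1)[OF assms(1,2) PT_comp[OF assms(3) s_PT]] s(2)
    by (simp add: map_comp_assoc)
  show "u \<in> units A"
    using left_invertible_imp_units(2)[OF assms(1) PT_comp[OF s_PT assms(2)] assms(3)] s(3)
    by (simp add: map_comp_assoc)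
qed

text \<open>A function with \<open>p permutes A\<close> is the identity off \<open>A\<close>, while
  members of \<open>PT A A\<close> are undefined there; this passes from the former to the
  latter.\<close>

definition perm_map :: "'a set \<Rightarrow> ('a \<Rightarrow> 'a) \<Rightarrow> 'a \<rightharpoonup> 'a" where
  "perm_map A p x = (if x \<in> A then Some (p x) else None)"

lemma perm_map_comp: "q permutes A \<Longrightarrow> perm_map A (p \<circ> q) = perm_map A p \<circ>\<^sub>m perm_map A q"
  by (rule ext) (simp add: perm_map_def map_comp_def permutes_in_image)

lemma perm_map_id: "perm_map A id = idp A"
  by (rule ext) (simp add: perm_map_def)

lemma perm_map_units:
  assumes "p permutes A"
  shows "perm_map A p \<in> units A"
proof -
  have "perm_map A q \<in> PT A A" if "q permutes A" for q
    using that by (auto simp: PT_iff perm_map_def permutes_in_image split: if_splits)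
  moreover have "perm_map A (inv p) \<circ>\<^sub>m perm_map A p = idp A"
    using perm_map_comp[OF assms, of "inv p"] permutes_inv_o(2)[OF assms] perm_map_id by metis
  moreover have "perm_map A p \<circ>\<^sub>m perm_map A (inv p) = idp A"
    using perm_map_comp[OF permutes_inv[OF assms], of p] permutes_inv_o(1)[OF assms] perm_map_id
    by metis
  ultimately show ?thesis using assms permutes_inv[OF assms] unfolding units_def by blast
qed

lemma total_injective_eq_perm_map:
  assumes "finite A" "t \<in> PT A A" "dom t = A" "inj_on t A"
  obtains p where "p permutes A" "t = perm_map A p"
proof
  let ?p = "\<lambda>x. if x \<in> A then the (t x) else x"
  have t: "t x = (if x \<in> A then Some (?p x) else None)" for x
    using assms(3) by auto
  have "inj_on ?p A" using assms(3,4) by (auto simp: inj_on_def dom_def)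
  moreover have "?p ` A \<subseteq> A" using assms(2,3) by (fastforce simp: PT_iff dom_def)
  ultimately have "bij_betw ?p A A" 
    using endo_inj_surj[OF assms(1), of ?p] unfolding bij_betw_def by blast
  then show "?p permutes A" by (rule bij_imp_permutes) simp
  show "t = perm_map A ?p" using t by (auto simp: perm_map_def)
qed

lemma units_total_injective:
  assumes "t \<in> units A"
  shows "dom t = A" and "ran t = A" and "inj_on t A"
proof -
  obtain s where s: "s \<in> units A" "s \<circ>\<^sub>m t = idp A" "t \<circ>\<^sub>m s = idp A"
    using units_inverse[OF assms] .
  have A: "dom t \<subseteq> A" "ran t \<subseteq> A" using units_PT[OF assms] by (auto simp: PT_def)
  have st: "\<exists>y. t x = Some y \<and> s y = Some x" if "x \<in> A" for x
    using fun_cong[OF s(2), of x] that by (simp add: map_comp_Some_iff)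
  have ts: "\<exists>y. s x = Some y \<and> t y = Some x" if "x \<in> A" for x
    using fun_cong[OF s(3), of x] that by (simp add: map_comp_Some_iff)
  show "dom t = A" using A st by blast
  show "ran t = A" using A ts by (blast intro: ranI)
  show "inj_on t A" by (rule inj_onI) (metis st option.sel)
qed

lemma units_iff:
  assumes "finite A" "t \<in> PT A A"
  shows "t \<in> units A \<longleftrightarrow> dom t = A \<and> inj_on t A"
  using assms units_total_injective total_injective_eq_perm_map perm_map_units by metis

section \<open>Generators of the monoid of partial self-maps\<close>

definition collapse :: "'a set \<Rightarrow> 'a \<Rightarrow> 'a \<Rightarrow> 'a \<rightharpoonup> 'a" where
  "collapse A x y = (idp A)(x \<mapsto> y)"

text \<open>Induction from the top rank downwards. A non-unit \<open>t\<close> misses some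
  \<open>z\<close>. If it is undefined at \<open>x\<close>, it is \<open>t(x \<mapsto> z)\<close>
  after the deletion of \<open>x\<close>; if it is total, it identifies some \<open>x\<close> and
  \<open>y\<close> and is \<open>t(x \<mapsto> z)\<close> after the collapse of \<open>x\<close> to
  \<open>y\<close>. The new factor has larger rank. Conjugation by permutations turns one deletion
  and one collapse into all of them.\<close>

lemma PT_generated:
  assumes fin: "finite A" and H: "units A \<subseteq> H"
    and closed: "\<And>t u. t \<in> H \<Longrightarrow> u \<in> H \<Longrightarrow> t \<circ>\<^sub>m u \<in> H"
    and p: "p \<in> A" "idp (A - {p}) \<in> H"
    and coll: "card A \<ge> 2 \<Longrightarrow> \<exists>x\<in>A. \<exists>y\<in>A. x \<noteq> y \<and> collapse A x y \<in> H"
  shows "PT A A \<subseteq> H"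
proof -
  have perm: "perm_map A q \<in> H" if "q permutes A" for q using perm_map_units[OF that] H by blast
  have del: "idp (A - {x}) \<in> H" if "x \<in> A" for x
  proof -
    let ?q = "transpose x p"
    have q: "?q permutes A" using that p by (auto intro: permutes_swap_id)
    have "idp (A - {x}) = perm_map A ?q \<circ>\<^sub>m (idp (A - {p}) \<circ>\<^sub>m perm_map A ?q)"
      using permutes_in_image[OF q] that p
      by (intro ext) (auto simp: map_comp_def perm_map_def transpose_eq_iff split: if_splits)
    then show ?thesis using perm[OF q] p closed by metis
  qed
  have fold: "collapse A x y \<in> H" if xy: "x \<in> A" "y \<in> A" "x \<noteq> y" for x y
  proof -
    have "card {x, y} \<le> card A" using xy fin by (intro card_mono) auto
    then obtain v w where vw: "v \<in> A" "w \<in> A" "v \<noteq> w" "collapse A v w \<in> H"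
      using coll xy by auto
    obtain q where q: "q permutes A" and qxy: "q x = v" "q y = w"
    proof
      \<comment> \<open>First \<open>x\<close> and \<open>v\<close> are swapped, then the place
        \<open>?z\<close> where \<open>y\<close> has landed is swapped with \<open>w\<close>. As
        \<open>y\<close> differs from \<open>x\<close>, \<open>?z\<close> is not \<open>v\<close>,
        so the second swap leaves the image of \<open>x\<close> alone.\<close>
      let ?z = "transpose x v y"
      have "?z \<in> A" using xy vw by (metis permutes_in_image permutes_swap_id)
      then show "transpose ?z w \<circ> transpose x v permutes A"
        using xy vw by (intro permutes_compose permutes_swap_id)
      have "?z \<noteq> v" using xy by (auto simp: transpose_eq_iff)
      then show "(transpose ?z w \<circ> transpose x v) x = v" using vw by simp
      show "(transpose ?z w \<circ> transpose x v) y = w" by simp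
    qed
    have inv: "inv q (q u) = u" for u using permutes_inverses(2)[OF q] by simp
    have "perm_map A (inv q) \<circ>\<^sub>m (collapse A v w \<circ>\<^sub>m perm_map A q) = collapse A x y"
    proof
      fix u
      have uA: "q u \<in> A \<longleftrightarrow> u \<in> A" using permutes_in_image[OF q] .
      have "q u = v \<longleftrightarrow> u = x" using inv qxy by metis
      moreover have "inv q w = y" using inv qxy by metis
      ultimately show "(perm_map A (inv q) \<circ>\<^sub>m (collapse A v w \<circ>\<^sub>m perm_map A q)) u = collapse A x y u"
        using inv[of u] uA xy vw qxy by (auto simp add: map_comp_def perm_map_def collapse_def)
    qed
    then show ?thesis using closed vw perm[OF q] perm[OF permutes_inv[OF q]] by metis
  qed
  have "t \<in> H" if "t \<in> PT A A" for t
    using that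
  proof (induction "card A - card (ran t)" arbitrary: t rule: less_induct)
    case less
    have t: "t x = Some y \<Longrightarrow> x \<in> A \<and> y \<in> A" for x y using less.prems by (simp add: PT_iff)
    have ran: "ran t \<subseteq> A" using less.prems by (simp add: PT_def)
    have finr: "finite (ran t)" using finite_subset[OF ran fin] .
    show ?case
    proof (cases "t \<in> units A")
      case False
      have img: "ran t = (\<lambda>x. the (t x)) ` dom t" by (force simp: ran_def dom_def)
      have dom: "dom t \<subseteq> A" using less.prems by (simp add: PT_def)
      \<comment> \<open>By counting, a map onto \<open>A\<close> must be total and injective, hence
        a unit.\<close>
      have "ran t \<noteq> A"
      proof
        assume r: "ran t = A"
        have "card A \<le> card (dom t)" using img r card_image_le finite_subset[OF dom fin] by metis
        then have d: "dom t = A" using dom fin card_seteq by metis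
        then have "inj_on (\<lambda>x. the (t x)) A" using img r fin eq_card_imp_inj_on by metis
        then have "inj_on t A" by (auto simp: inj_on_def)
        then show False using False d less.prems units_iff[OF fin] by blast
      qed
      then obtain z where z: "z \<in> A" "z \<notin> ran t" using ran by blast
      have dec: "card A - card (ran u) < card A - card (ran t)" if "ran u = insert z (ran t)" for u :: "'a \<rightharpoonup> 'a"
      proof -
        have "card (ran u) = Suc (card (ran t))" using that z finr by simp
        moreover have "card (ran u) \<le> card A" using that z ran fin by (simp add: card_mono)
        ultimately show ?thesis by linarith
      qed
      show ?thesis
      proof (cases "dom t = A")
        case False
        then obtain x where x: "x \<in> A" "t x = None" using dom by blast
        let ?u = "t(x \<mapsto> z)"
        have "ran ?u = insert z (ran t)" using x by simp
        moreover have "?u \<in> PT A A" using less.prems x z by (simp add: PT_iff)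
        ultimately have "?u \<in> H" using less.hyps dec by blast
        moreover have "t = ?u \<circ>\<^sub>m idp (A - {x})"
          by (rule ext) (use x t in \<open>auto simp: map_comp_def, metis option.exhaust\<close>)
        ultimately show ?thesis using del x closed by metis
      next
        case True
        then have "\<not> inj_on t A" using False less.prems units_iff[OF fin] by blast
        then obtain x y where xy: "x \<in> A" "y \<in> A" "x \<noteq> y" "t x = t y" by (auto simp: inj_on_def)
        \<comment> \<open>Only \<open>x\<close> is moved to \<open>z\<close>; \<open>y\<close> keeps
          the common value, so nothing is lost from the range.\<close>
        let ?u = "t(x \<mapsto> z)"
        have "ran ?u = insert z (ran t)"
          using xy by (auto simp: ran_def) metis
        moreover have "?u \<in> PT A A" using less.prems xy z by (simp add: PT_iff)
        ultimately have "?u \<in> H" using less.hyps dec by blast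
        moreover have "t = ?u \<circ>\<^sub>m collapse A x y"
          by (rule ext) (use xy t in \<open>auto simp: map_comp_def collapse_def, metis option.exhaust\<close>)
        ultimately show ?thesis using fold xy closed by metis
      qed
    qed (use H in blast)
  qed
  then show ?thesis by blast
qed

subsection \<open>Coordinates for the regular elements\<close>

text \<open>The generalised inverse chooses a preimage of each point of the range.\<close>

lemma PT_regular:
  assumes "t \<in> PT A B"
  obtains u where "u \<in> PT B A" "t \<circ>\<^sub>m (u \<circ>\<^sub>m t) = t"
proof
  let ?u = "\<lambda>y. if y \<in> ran t then Some (SOME x. t x = Some y) else None"
  have u: "t (SOME x. t x = Some y) = Some y" if "t x = Some y" for x y
    using that by (rule someI)
  show "?u \<in> PT B A" using assms u by (fastforce simp: PT_iff ran_def)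
  show "t \<circ>\<^sub>m (?u \<circ>\<^sub>m t) = t"
    by (rule ext) (auto simp: map_comp_def ran_def u split: option.splits)
qed

definition retractions :: "'x set \<Rightarrow> 'x set \<Rightarrow> ('x \<rightharpoonup> 'x) set" where
  "retractions X A = {r \<in> PT X A. r \<circ>\<^sub>m idp A = idp A}"

definition sections :: "('y \<rightharpoonup> 'x) \<Rightarrow> ('x \<rightharpoonup> 'y) set" where
  "sections a = {c. dom c = ran a \<and> a \<circ>\<^sub>m c = idp (ran a)}"

text \<open>Coordinates as in a Rees matrix semigroup with trivial sandwich matrix, with
  \<open>r\<close> as row, \<open>t\<close> as entry and \<open>c\<close> as column.\<close>

definition rees :: "('x \<rightharpoonup> 'x) \<Rightarrow> ('x \<rightharpoonup> 'x) \<Rightarrow> ('x \<rightharpoonup> 'y) \<Rightarrow> ('x \<rightharpoonup> 'y)" where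
  "rees r t c = c \<circ>\<^sub>m (t \<circ>\<^sub>m r)"

text \<open>The middle coordinate is recovered because \<open>a\<close> undoes the section and a
  retraction is the identity on \<open>ran a\<close>.\<close>

definition core :: "('y \<rightharpoonup> 'x) \<Rightarrow> ('x \<rightharpoonup> 'y) \<Rightarrow> ('x \<rightharpoonup> 'x)" where
  "core a f = (a \<circ>\<^sub>m f) \<circ>\<^sub>m idp (ran a)"

lemma retraction_PT: "r \<in> retractions X A \<Longrightarrow> r \<in> PT X A"
  by (simp add: retractions_def)

lemma retraction_comp: "r \<in> retractions X A \<Longrightarrow> f \<in> PT B A \<Longrightarrow> r \<circ>\<^sub>m f = f"
  unfolding retractions_def by (metis (mono_tags, lifting) idp_comp_left map_comp_assoc mem_Collect_eq)

lemma retraction_idp: "r \<in> retractions X A \<Longrightarrow> r \<circ>\<^sub>m idp A = idp A"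
  by (simp add: retractions_def)

lemma retractions_iff:
  "A \<subseteq> X \<Longrightarrow> r \<in> retractions X A \<longleftrightarrow> r \<in> PT X A \<and> (\<forall>x\<in>A. r x = Some x)"
  unfolding retractions_def by (auto simp: fun_eq_iff map_comp_def split: if_splits)

lemma sections_iff: "c \<in> sections a \<longleftrightarrow>
    dom c \<subseteq> ran a \<and> (\<forall>x\<in>ran a. \<exists>y. c x = Some y \<and> a y = Some x)"
  (is "_ \<longleftrightarrow> ?rhs")
proof
  assume c: "c \<in> sections a"
  have "\<exists>y. c x = Some y \<and> a y = Some x" if "x \<in> ran a" for x
  proof -
    have "(a \<circ>\<^sub>m c) x = Some x" using c that by (simp add: sections_def)
    then show ?thesis by (auto simp: map_comp_Some_iff)
  qed
  then show ?rhs using c by (auto simp: sections_def)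
next
  assume c: ?rhs
  have "(a \<circ>\<^sub>m c) x = idp (ran a) x" for x
    using c by (cases "x \<in> ran a") (fastforce simp: map_comp_Some_iff, auto simp: map_comp_None_iff)
  then have "a \<circ>\<^sub>m c = idp (ran a)" by blast
  moreover have "dom c = ran a" using c by blast
  ultimately show "c \<in> sections a" by (simp add: sections_def)
qed

lemma section_comp: "c \<in> sections a \<Longrightarrow> f \<in> PT B (ran a) \<Longrightarrow> a \<circ>\<^sub>m (c \<circ>\<^sub>m f) = f"
  unfolding sections_def by (metis (mono_tags, lifting) idp_comp_left map_comp_assoc mem_Collect_eq)

locale sandwich_PT =
  fixes X :: "'x set" and Y :: "'y set" and a :: "'y \<rightharpoonup> 'x"
  assumes a_PT: "a \<in> PT Y X"
begin

abbreviation "A \<equiv> ran a"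
abbreviation "Ret \<equiv> retractions X A"
abbreviation "Sec \<equiv> sections a"
abbreviation "P \<equiv> RegPT X Y a"

lemma A_subset: "A \<subseteq> X"
  using a_PT by (simp add: PT_def)

lemma section_PT: "c \<in> Sec \<Longrightarrow> c \<in> PT A Y"
  using a_PT by (fastforce simp: sections_iff PT_iff)

lemma idp_retraction: "idp A \<in> Ret"
  using A_subset by (auto simp: retractions_iff PT_iff)

lemma section_exists: "\<exists>c. c \<in> Sec"
proof
  let ?c = "\<lambda>x. if x \<in> A then Some (SOME y. a y = Some x) else None"
  show "?c \<in> Sec"
    by (auto simp: sections_iff ran_def dom_def intro: someI split: if_splits)
qed

lemma rees_PT: "r \<in> Ret \<Longrightarrow> t \<in> PT A A \<Longrightarrow> c \<in> Sec \<Longrightarrow> rees r t c \<in> PT X Y"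
  unfolding rees_def by (intro PT_comp[of _ _ A]) (auto intro: retraction_PT section_PT)

text \<open>Between the two cores stand \<open>c\<close>, \<open>a\<close> and \<open>r'\<close>:
  \<open>a\<close> undoes \<open>c\<close>, and \<open>r'\<close> fixes \<open>A\<close> pointwise,
  so all three vanish.\<close>

lemma rees_mult:
  assumes "r \<in> Ret" "t \<in> PT A A" "c \<in> Sec" "r' \<in> Ret" "t' \<in> PT A A" "c' \<in> Sec"
  shows "sandwich a (rees r t c) (rees r' t' c') = rees r (t' \<circ>\<^sub>m t) c'"
proof -
  have tr: "t \<circ>\<^sub>m r \<in> PT X A" using assms retraction_PT PT_comp by blast
  show ?thesis
    using section_comp[OF assms(3) tr] retraction_comp[OF assms(4) tr]
    by (simp add: sandwich_def rees_def map_comp_assoc)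
qed

lemma core_rees:
  assumes "r \<in> Ret" "t \<in> PT A A" "c \<in> Sec"
  shows "core a (rees r t c) = t"
proof -
  have "t \<circ>\<^sub>m r \<in> PT X A" using assms retraction_PT PT_comp by blast
  then show ?thesis
    using assms by (simp add: core_def rees_def section_comp retraction_idp idp_comp_right map_comp_assoc)
qed

text \<open>An invertible core can be cancelled: with its inverse \<open>s\<close>, applying
  \<open>a\<close> and \<open>s\<close> after the element leaves the retraction, and applying
  \<open>s\<close> before it leaves the section. In general only the core is determined.\<close>

lemma rees_inject:
  assumes "r \<in> Ret" "t \<in> units A" "c \<in> Sec" "r' \<in> Ret" "t' \<in> PT A A" "c' \<in> Sec"
    and eq: "rees r t c = rees r' t' c'"
  shows "r = r'" and "t = t'" and "c = c'"
proof -
  show t: "t = t'" using core_rees assms units_PT by metis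
  obtain s where s: "s \<in> units A" "s \<circ>\<^sub>m t = idp A" "t \<circ>\<^sub>m s = idp A"
    using assms(2) by (rule units_inverse)
  have r: "s \<circ>\<^sub>m (a \<circ>\<^sub>m rees q t d) = q" if "q \<in> Ret" "d \<in> Sec" for q d
  proof -
    have "t \<circ>\<^sub>m q \<in> PT X A" using that assms units_PT retraction_PT PT_comp by blast
    then have "s \<circ>\<^sub>m (a \<circ>\<^sub>m rees q t d) = (s \<circ>\<^sub>m t) \<circ>\<^sub>m q"
      using that by (simp add: rees_def section_comp map_comp_assoc)
    then show ?thesis using that s by (metis idp_comp_left retraction_PT)
  qed
  then show "r = r'" using assms t by metis
  have c: "rees q t d \<circ>\<^sub>m s = d" if "q \<in> Ret" "d \<in> Sec" for q d
  proof -
    have "rees q t d \<circ>\<^sub>m s = d \<circ>\<^sub>m (t \<circ>\<^sub>m s)"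
      by (simp add: rees_def map_comp_assoc retraction_comp[OF that(1) units_PT[OF s(1)]])
    then show ?thesis using s idp_comp_right[OF section_PT[OF that(2)]] by simp
  qed
  then show "c = c'" using assms t by metis
qed

lemma RegPT_eq_rees: "P = {rees r t c | r t c. r \<in> Ret \<and> t \<in> PT A A \<and> c \<in> Sec}"
proof (intro equalityI subsetI)
  fix f assume "f \<in> P"
  then obtain g where f: "f \<in> PT X Y" and g: "g \<in> PT X Y"
    and fg: "f = sandwich a (sandwich a f g) f"
    unfolding RegPT_def by blast
  define h where "h = a \<circ>\<^sub>m g"
  have hA: "y \<in> A" if "h x = Some y" for x y
    using that by (auto simp: h_def map_comp_Some_iff intro: ranI)
  have reg: "\<exists>p p'. a y = Some p \<and> h p = Some p' \<and> f p' = Some y" if "f x = Some y" for x y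
  proof -
    have "sandwich a (sandwich a f g) f x = Some y" using fg that by metis
    then show ?thesis using that by (auto simp: sandwich_def h_def map_comp_Some_iff)
  qed
  \<comment> \<open>Regularity reads
    \<open>f = f \<circ>\<^sub>m h \<circ>\<^sub>m a \<circ>\<^sub>m f\<close>. Off
    \<open>A\<close>, \<open>r\<close> follows \<open>f\<close>, \<open>a\<close> and
    \<open>h\<close>, which leads to a point of \<open>A\<close> with the same image under
    \<open>f\<close>.\<close>
  define r where "r x = (if x \<in> A then Some x else case f x of None \<Rightarrow> None | Some y \<Rightarrow> h (the (a y)))" for x
  \<comment> \<open>The section must return the value of \<open>f\<close> from its image under
    \<open>a\<close>; \<open>f\<close> after \<open>h\<close> does so on the points that occur, and
    elsewhere any preimage serves.\<close>
  define c where "c p = (if p \<in> A then Some (if \<exists>y. (f \<circ>\<^sub>m h) p = Some y \<and> a y = Some p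
      then the ((f \<circ>\<^sub>m h) p) else (SOME y. a y = Some p)) else None)" for p
  have "r \<in> Ret"
    using f hA A_subset
    by (auto simp: retractions_iff r_def PT_iff split: if_splits option.splits)
  moreover have "core a f \<in> PT A A"
    by (auto simp: PT_iff core_def map_comp_Some_iff intro: ranI split: if_splits)
  moreover have "c \<in> Sec"
  proof -
    have "\<exists>y. c p = Some y \<and> a y = Some p" if "p \<in> A" for p
    proof (cases "\<exists>y. (f \<circ>\<^sub>m h) p = Some y \<and> a y = Some p")
      case True
      then show ?thesis using that by (auto simp: c_def)
    next
      case False
      have "a (SOME y. a y = Some p) = Some p"
        using that by (auto simp: ran_def intro: someI)
      then show ?thesis using that False by (auto simp: c_def)
    qed
    moreover have "dom c \<subseteq> A" by (auto simp: c_def split: if_splits)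
    ultimately show ?thesis by (simp add: sections_iff)
  qed
  moreover have "f = rees r (core a f) c"
  proof
    fix x
    show "f x = rees r (core a f) c x"
    proof (cases "f x")
      case None
      then show ?thesis by (simp add: rees_def core_def r_def map_comp_def)
    next
      case (Some y)
      then obtain p p' where p: "a y = Some p" "h p = Some p'" "f p' = Some y"
        using reg by blast
      then have A: "p \<in> A" "p' \<in> A" using hA by (auto intro: ranI)
      then have "c p = Some y" using p by (simp add: c_def map_comp_def)
      then show ?thesis
        using p A Some by (simp add: rees_def core_def r_def map_comp_def)
    qed
  qed
  ultimately show "f \<in> {rees r t c | r t c. r \<in> Ret \<and> t \<in> PT A A \<and> c \<in> Sec}" by blast
next
  fix f assume "f \<in> {rees r t c | r t c. r \<in> Ret \<and> t \<in> PT A A \<and> c \<in> Sec}"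
  then obtain r t c where f: "f = rees r t c" and rtc: "r \<in> Ret" "t \<in> PT A A" "c \<in> Sec" by blast
  \<comment> \<open>For the converse, a generalised inverse of the core gives one of the whole
    element, with \<open>r\<close> and \<open>c\<close> kept.\<close>
  obtain u where u: "u \<in> PT A A" "t \<circ>\<^sub>m (u \<circ>\<^sub>m t) = t" using PT_regular[OF rtc(2)] .
  have "f = sandwich a (sandwich a f (rees r u c)) f"
    using f rtc u PT_comp[OF rtc(2) u(1)] by (simp add: rees_mult)
  then show "f \<in> P" using f rtc u rees_PT unfolding RegPT_def by blast
qed

lemma reesI: "r \<in> Ret \<Longrightarrow> t \<in> PT A A \<Longrightarrow> c \<in> Sec \<Longrightarrow> rees r t c \<in> P"
  using RegPT_eq_rees by blast

lemma RegPT_cases: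
  assumes "f \<in> P"
  obtains r t c where "r \<in> Ret" "t \<in> PT A A" "c \<in> Sec" "f = rees r t c"
  using assms RegPT_eq_rees by blast

lemma P_closed: "f \<in> P \<Longrightarrow> g \<in> P \<Longrightarrow> sandwich a f g \<in> P"
  by (elim RegPT_cases) (simp add: rees_mult reesI PT_comp)

lemma core_PT: "f \<in> P \<Longrightarrow> core a f \<in> PT A A"
  by (elim RegPT_cases) (simp add: core_rees)

lemma core_mult: "f \<in> P \<Longrightarrow> g \<in> P \<Longrightarrow> core a (sandwich a f g) = core a g \<circ>\<^sub>m core a f"
  by (elim RegPT_cases) (simp add: rees_mult core_rees PT_comp)

lemma generated_in_P: "\<Gamma> \<subseteq> P \<Longrightarrow> f \<in> sgp_gen (sandwich a) \<Gamma> \<Longrightarrow> f \<in> P"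
  using sgp_gen_closed[of \<Gamma> P "sandwich a"] P_closed by blast

text \<open>In a product with invertible core all factors have invertible core. The retraction comes
  from the first factor and the section from the last, so each already occurs in a
  generator.\<close>

lemma generator_coordinates:
  assumes "finite A" "\<Gamma> \<subseteq> P" "f \<in> sgp_gen (sandwich a) \<Gamma>"
    and "r \<in> Ret" "t \<in> units A" "c \<in> Sec" "f = rees r t c"
  shows "\<exists>t'\<in>units A. \<exists>c'\<in>Sec. rees r t' c' \<in> \<Gamma>"
    and "\<exists>t'\<in>units A. \<exists>r'\<in>Ret. rees r' t' c \<in> \<Gamma>"
proof -
  have "(\<exists>t'\<in>units A. \<exists>c'\<in>Sec. rees r t' c' \<in> \<Gamma>) \<and> (\<exists>t'\<in>units A. \<exists>r'\<in>Ret. rees r' t' c \<in> \<Gamma>)"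
    using assms(3-)
  proof (induction arbitrary: r t c)
    case (incl x)
    then show ?case by blast
  next
    case (mult x y)
    obtain r1 t1 c1 where x: "r1 \<in> Ret" "t1 \<in> PT A A" "c1 \<in> Sec" "x = rees r1 t1 c1"
      using generated_in_P[OF assms(2) mult.hyps(1)] by (rule RegPT_cases)
    obtain r2 t2 c2 where y: "r2 \<in> Ret" "t2 \<in> PT A A" "c2 \<in> Sec" "y = rees r2 t2 c2"
      using generated_in_P[OF assms(2) mult.hyps(2)] by (rule RegPT_cases)
    have "rees r t c = rees r1 (t2 \<circ>\<^sub>m t1) c2"
      using mult.prems x y by (simp add: rees_mult)
    note eq = rees_inject[OF mult.prems(1-3) x(1) PT_comp[OF x(2) y(2)] y(3) this]
    have "t1 \<in> units A" "t2 \<in> units A"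
      using comp_units_imp_units[OF assms(1) x(2) y(2)] eq mult.prems by blast+
    then show ?case using mult.IH x y eq by metis
  qed
  then show "\<exists>t'\<in>units A. \<exists>c'\<in>Sec. rees r t' c' \<in> \<Gamma>"
    and "\<exists>t'\<in>units A. \<exists>r'\<in>Ret. rees r' t' c \<in> \<Gamma>" by blast+
qed

text \<open>Reading off a coordinate, which is unique for invertible cores, maps \<open>T\<close>
  over all retractions and over all sections. The form as an image serves both the counting bound
  and the proof that finitely many generators give finitely many coordinates.\<close>

lemma generator_unit_surjections:
  assumes "finite A" "\<Gamma> \<subseteq> P" "sgp_gen (sandwich a) \<Gamma> = P"
  defines "T \<equiv> {f \<in> \<Gamma>. core a f \<in> units A}"
  shows "\<exists>h. Ret \<subseteq> h ` T" and "\<exists>h. Sec \<subseteq> h ` T"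
proof -
  obtain c0 where c0: "c0 \<in> Sec" using section_exists by blast
  let ?h = "\<lambda>f. THE r. r \<in> Ret \<and> (\<exists>t\<in>units A. \<exists>c\<in>Sec. f = rees r t c)"
  have "r \<in> ?h ` T" if r: "r \<in> Ret" for r
  proof -
    have "rees r (idp A) c0 \<in> sgp_gen (sandwich a) \<Gamma>"
      using assms r c0 reesI idp_PT by blast
    then obtain t c where t: "t \<in> units A" and c: "c \<in> Sec" and f: "rees r t c \<in> \<Gamma>"
      using generator_coordinates(1) assms(1,2) r c0 idp_units by blast
    have "?h (rees r t c) = r"
      using t c r rees_inject(1) units_PT by (intro the_equality) blast+
    moreover have "rees r t c \<in> T" using f t c r core_rees units_PT by (fastforce simp: T_def)
    ultimately show ?thesis by (rule image_eqI[OF sym])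
  qed
  then show "\<exists>h. Ret \<subseteq> h ` T" by blast
  let ?k = "\<lambda>f. THE c. c \<in> Sec \<and> (\<exists>t\<in>units A. \<exists>r\<in>Ret. f = rees r t c)"
  have "c \<in> ?k ` T" if c: "c \<in> Sec" for c
  proof -
    have "rees (idp A) (idp A) c \<in> sgp_gen (sandwich a) \<Gamma>"
      using assms c idp_retraction reesI idp_PT by blast
    then obtain t r where t: "t \<in> units A" and r: "r \<in> Ret" and f: "rees r t c \<in> \<Gamma>"
      using generator_coordinates(2) assms(1,2) c idp_retraction idp_units by blast
    have "?k (rees r t c) = c"
      using t c r rees_inject(3) units_PT by (intro the_equality) blast+
    moreover have "rees r t c \<in> T" using f t c r core_rees units_PT by (fastforce simp: T_def)
    ultimately show ?thesis by (rule image_eqI[OF sym])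
  qed
  then show "\<exists>h. Sec \<subseteq> h ` T" by blast
qed

end

subsection \<open>Generating sets\<close>

text \<open>Enumeration with repetitions: indices beyond the cardinality all go to the first
  element, so that lists of different lengths can share one index range.\<close>

lemma finite_surj_lessThan:
  assumes "finite K" "K \<noteq> {}" "card K \<le> N"
  obtains u :: "nat \<Rightarrow> 'a" where "u ` {..<N} = K"
proof -
  obtain h where h: "bij_betw h {0..<card K} K" using ex_bij_betw_nat_finite[OF assms(1)] by blast
  have "card K > 0" using assms by (simp add: card_gt_0_iff)
  let ?u = "\<lambda>i. if i < card K then h i else h 0"
  have "?u ` {..<N} \<subseteq> K" using h \<open>card K > 0\<close> by (auto simp: bij_betw_def)
  moreover have "K \<subseteq> ?u ` {..<N}"
  proof
    fix x assume "x \<in> K"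
    then obtain i where "i < card K" "x = h i" using h by (force simp: bij_betw_def)
    then show "x \<in> ?u ` {..<N}" using assms(3) by (intro image_eqI[of _ _ i]) auto
  qed
  ultimately show thesis using that by blast
qed

lemma perm_map_sgp_gen:
  assumes "\<And>b. b \<in> B \<Longrightarrow> b permutes A" and "r \<in> sgp_gen (\<circ>) B"
  shows "perm_map A r \<in> sgp_gen (\<circ>\<^sub>m) (perm_map A ` B)"
proof -
  have perm: "sgp_gen (\<circ>) B \<subseteq> {r. r permutes A}"
    using assms(1) permutes_compose by (intro sgp_gen_closed) auto
  show ?thesis
    using assms(2)
  proof induction
    case (incl x)
    then show ?case by (auto intro: sgp_gen.incl)
  next
    case (mult x y)
    then have "y permutes A" using perm by blast
    from perm_map_comp[OF this, of x] show ?case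
      using sgp_gen.mult[OF mult.IH] by (simp only:)
  qed
qed

text \<open>The first factor \<open>t\<close> must be total. If it is also injective it is a unit,
  and undoing it transfers both properties to \<open>u\<close>.\<close>

lemma total_noninjective_prime:
  assumes "finite A" "t \<in> PT A A" "u \<in> PT A A"
    and "dom (u \<circ>\<^sub>m t) = A" "\<not> inj_on (u \<circ>\<^sub>m t) A"
  shows "(dom t = A \<and> \<not> inj_on t A) \<or> (dom u = A \<and> \<not> inj_on u A)"
proof -
  have "dom (u \<circ>\<^sub>m t) \<subseteq> dom t" by (auto simp: map_comp_Some_iff)
  then have t: "dom t = A" using assms(2,4) by (auto simp: PT_def)
  have "dom u = A \<and> \<not> inj_on u A" if inj: "inj_on t A"
  proof
    have unit: "t \<in> units A" using t inj assms units_iff by blast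
    show u: "dom u = A"
    proof
      show "dom u \<subseteq> A" using assms(3) by (simp add: PT_def)
      show "A \<subseteq> dom u"
      proof
        fix y assume "y \<in> A"
        then obtain x where x: "t x = Some y"
          using units_total_injective(2)[OF unit] by (force simp: ran_def)
        then have "x \<in> dom (u \<circ>\<^sub>m t)" using assms(4) t by blast
        then show "y \<in> dom u" using x by (auto simp: map_comp_Some_iff)
      qed
    qed
    show "\<not> inj_on u A"
    proof
      assume "inj_on u A"
      then have "u \<in> units A" using u units_iff[OF assms(1,3)] by blast
      then have "u \<circ>\<^sub>m t \<in> units A" using unit units_comp by blast
      then show False using assms(5) units_total_injective(3) by blast
    qed
  qed
  then show ?thesis using t by blast
qed

definition corank_one_injective :: "'a set \<Rightarrow> ('a \<rightharpoonup> 'a) \<Rightarrow> bool" where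
  "corank_one_injective A t \<longleftrightarrow> (\<exists>x\<in>A. dom t = A - {x} \<and> inj_on t (A - {x}))"

text \<open>The first factor \<open>t\<close> is injective away from \<open>x\<close>. If it is
  undefined at \<open>x\<close> it has the property itself; if it is total it is a unit, and
  \<open>u\<close> is the product up to a unit.\<close>

lemma corank_one_injective_prime:
  assumes "finite A" "t \<in> PT A A" "u \<in> PT A A" "corank_one_injective A (u \<circ>\<^sub>m t)"
  shows "corank_one_injective A t \<or> corank_one_injective A u"
proof -
  obtain x where x: "x \<in> A" "dom (u \<circ>\<^sub>m t) = A - {x}" "inj_on (u \<circ>\<^sub>m t) (A - {x})"
    using assms(4) unfolding corank_one_injective_def by blast
  have eq: "(u \<circ>\<^sub>m t) y = (u \<circ>\<^sub>m t) z" if "t y = t z" for y z using that by (simp add: map_comp_def)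
  have "dom (u \<circ>\<^sub>m t) \<subseteq> dom t" by (auto simp: map_comp_Some_iff)
  then have sub: "A - {x} \<subseteq> dom t" using x(2) by simp
  have tA: "dom t \<subseteq> A" using assms(2) by (simp add: PT_def)
  have inj: "inj_on t (A - {x})"
  proof (rule inj_onI)
    fix y z assume "y \<in> A - {x}" "z \<in> A - {x}" "t y = t z"
    then show "y = z" using inj_onD[OF x(3) eq[of y z]] by blast
  qed
  show ?thesis
  proof (cases "dom t = A")
    case False
    then have "dom t = A - {x}" using sub tA x(1) by blast
    then show ?thesis using inj x(1) unfolding corank_one_injective_def by blast
  next
    case True
    have none: "(u \<circ>\<^sub>m t) y = None \<longleftrightarrow> y = x" if "y \<in> A" for y
      using x(2) that by blast
    \<comment> \<open>The product is undefined at \<open>x\<close> only, so \<open>t\<close> cannot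
      send another point to where it sends \<open>x\<close>.\<close>
    have "inj_on t A"
    proof (rule inj_onI)
      fix y z assume yz: "y \<in> A" "z \<in> A" "t y = t z"
      then have "y = x \<longleftrightarrow> z = x" using eq none by metis
      then show "y = z" using yz inj by (auto simp: inj_on_def)
    qed
    then have unit: "t \<in> units A" using True assms units_iff by blast
    have surj: "\<exists>z\<in>A. t z = Some y" if "y \<in> A" for y
      using that units_total_injective(2)[OF unit] tA by (force simp: ran_def)
    \<comment> \<open>The image of \<open>x\<close> under \<open>t\<close> is the point at which
      \<open>u\<close> is undefined.\<close>
    obtain x' where x': "t x = Some x'" using True x(1) by blast
    have ut: "(u \<circ>\<^sub>m t) z = u y" if "t z = Some y" for y z using that by simp
    have "x' \<in> A" using x' assms(2) by (simp add: PT_iff)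
    moreover have none_u: "u y = None \<longleftrightarrow> y = x'" if "y \<in> A" for y
      using surj[OF that] ut none x' \<open>inj_on t A\<close> x(1) by (metis inj_on_contraD option.inject)
    have "y \<in> dom u \<longleftrightarrow> y \<in> A - {x'}" for y
      using none_u[of y] assms(3) by (auto simp: PT_iff dom_def)
    then have "dom u = A - {x'}" by blast
    moreover have "inj_on u (A - {x'})"
    proof (rule inj_onI)
      fix y z assume yz: "y \<in> A - {x'}" "z \<in> A - {x'}" "u y = u z"
      obtain y' z' where t: "y' \<in> A" "z' \<in> A" "t y' = Some y" "t z' = Some z"
        using yz surj by blast
      then have "y' \<noteq> x" "z' \<noteq> x" using yz x' by auto
      moreover have "(u \<circ>\<^sub>m t) y' = (u \<circ>\<^sub>m t) z'" using t yz ut by simp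
      ultimately have "y' = z'" using inj_onD[OF x(3)] t by blast
      then show "y = z" using t by simp
    qed
    ultimately show ?thesis unfolding corank_one_injective_def by blast
  qed
qed

lemma units_noncommutative:
  assumes "finite A" "card A \<ge> 3"
  obtains t u where "t \<in> units A" "u \<in> units A" "t \<circ>\<^sub>m u \<noteq> u \<circ>\<^sub>m t"
proof -
  obtain B where B: "B \<subseteq> A" "card B = 3" using obtain_subset_with_card_n[OF assms(2)] by metis
  then obtain x y z where xyz: "B = {x, y, z}" "x \<noteq> y" "y \<noteq> z" "x \<noteq> z" by (auto simp: card_3_iff)
  let ?t = "perm_map A (transpose x y)" and ?u = "perm_map A (transpose y z)"
  have "?t \<in> units A" "?u \<in> units A"
    using B xyz by (auto intro!: perm_map_units permutes_swap_id)
  moreover have "(?t \<circ>\<^sub>m ?u) x \<noteq> (?u \<circ>\<^sub>m ?t) x"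
    using B xyz by (simp add: perm_map_def map_comp_def)
  ultimately show thesis using that by metis
qed

section \<open>Lower bound for the size of a generating set\<close>

context sandwich_PT
begin

text \<open>A property that no product acquires unless some factor has it must be present among the
  generators.\<close>

lemma generator_prime:
  assumes "\<Gamma> \<subseteq> P" "f \<in> sgp_gen (sandwich a) \<Gamma>" "Q (core a f)"
    and prime: "\<And>t u. t \<in> PT A A \<Longrightarrow> u \<in> PT A A \<Longrightarrow> Q (u \<circ>\<^sub>m t) \<Longrightarrow> Q t \<or> Q u"
  shows "\<exists>g\<in>\<Gamma>. Q (core a g)"
  using assms(2,3)
proof induction
  case (mult x y)
  then have "x \<in> P" "y \<in> P" using generated_in_P[OF assms(1)] by blast+
  then show ?case using mult prime core_PT core_mult by metis
qed blast

text \<open>Generators with non-invertible core never take part in a product with invertible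
  core.\<close>

lemma core_in_unit_cores:
  assumes "finite A" "\<Gamma> \<subseteq> P" "f \<in> sgp_gen (sandwich a) \<Gamma>" "core a f \<in> units A"
  shows "core a f \<in> sgp_gen (\<circ>\<^sub>m) (core a ` {f \<in> \<Gamma>. core a f \<in> units A})"
  using assms(3,4)
proof induction
  case (incl x)
  then show ?case by (auto intro: sgp_gen.incl)
next
  case (mult x y)
  then have xy: "x \<in> P" "y \<in> P" using generated_in_P[OF assms(2)] by blast+
  note eq = core_mult[OF xy]
  have "core a x \<in> units A" "core a y \<in> units A"
    using comp_units_imp_units[OF assms(1) core_PT[OF xy(1)] core_PT[OF xy(2)]] mult.prems eq by auto
  then show ?case unfolding eq using mult.IH by (intro sgp_gen.mult)
qed

text \<open>Three kinds of generators are counted, pairwise disjoint by the type of their cores: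
  those in \<open>T\<close> with invertible core, one injective and undefined at one point, and, for
  at least two points, one total and not injective.\<close>

lemma generating_set_card_ge:
  assumes fin: "finite A" and \<Gamma>: "\<Gamma> \<subseteq> P" "sgp_gen (sandwich a) \<Gamma> = P" "finite \<Gamma>"
    and "card A \<ge> 1"
  shows "max (max (card Ret) (card Sec)) (if card A \<ge> 3 then 2 else 1)
    + (if card A = 1 then 1 else 2) \<le> card \<Gamma>"
proof -
  define T where "T = {f \<in> \<Gamma>. core a f \<in> units A}"
  have finT: "finite T" using \<Gamma> by (simp add: T_def)
  obtain c0 where c0: "c0 \<in> Sec" using section_exists by blast
  have lift: "\<exists>f\<in>P. core a f = t" if "t \<in> PT A A" for t
    using that reesI[OF idp_retraction that c0] core_rees[OF idp_retraction that c0] by blast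
  obtain h where h: "Ret \<subseteq> h ` T"
    using generator_unit_surjections(1)[OF fin \<Gamma>(1,2)] unfolding T_def by blast
  obtain k where k: "Sec \<subseteq> k ` T"
    using generator_unit_surjections(2)[OF fin \<Gamma>(1,2)] unfolding T_def by blast
  then have RS: "card Ret \<le> card T" "card Sec \<le> card T" 
    using surj_card_le[OF finT h] surj_card_le[OF finT k] by blast+
  have "Ret \<noteq> {}" using idp_retraction by blast
  then have "T \<noteq> {}" using h by blast
  then have T1: "1 \<le> card T" using finT by (simp add: Suc_leI card_gt_0_iff)
  \<comment> \<open>A single member of \<open>T\<close> would make the group of units monogenic and
    so commutative.\<close>
  have T2: "2 \<le> card T" if "card A \<ge> 3"
  proof (rule ccontr)
    assume "\<not> 2 \<le> card T"
    then have "card T = 1" using T1 by linarith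
    then obtain f0 where T: "T = {f0}" by (rule card_1_singletonE)
    have "t \<in> sgp_gen (\<circ>\<^sub>m) {core a f0}" if t: "t \<in> units A" for t
    proof -
      obtain f where f: "f \<in> sgp_gen (sandwich a) \<Gamma>" "core a f = t"
        using lift[OF units_PT[OF t]] \<Gamma>(2) by blast
      then show ?thesis
        using core_in_unit_cores[OF fin \<Gamma>(1) f(1)] t T unfolding T_def by simp
    qed
    then have "t \<circ>\<^sub>m u = u \<circ>\<^sub>m t" if "t \<in> units A" "u \<in> units A" for t u
      using that sgp_gen_singleton_commute[of "(\<circ>\<^sub>m)", OF map_comp_assoc] by blast
    then show False using units_noncommutative[OF fin that] by metis
  qed
  have T_max: "max (max (card Ret) (card Sec)) (if card A \<ge> 3 then 2 else 1) \<le> card T"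
    using RS T1 T2 by simp
  obtain x where x: "x \<in> A" using assms(5) by fastforce
  \<comment> \<open>A partial identity missing one point is the core of some element, so primality
    produces a generator of this type.\<close>
  have "corank_one_injective A (idp (A - {x}))"
    using x by (auto simp: corank_one_injective_def inj_on_def)
  moreover have "idp (A - {x}) \<in> PT A A" by (simp add: PT_iff)
  ultimately obtain g1 where g1: "g1 \<in> \<Gamma>" "corank_one_injective A (core a g1)"
    using generator_prime[OF \<Gamma>(1), where Q = "corank_one_injective A"]
      corank_one_injective_prime[OF fin] lift \<Gamma>(2) by metis
  have g1T: "g1 \<notin> T" "dom (core a g1) \<noteq> A"
    using g1(2) units_total_injective(1) by (fastforce simp: T_def corank_one_injective_def)+
  show ?thesis
  proof (cases "card A = 1")
    \<comment> \<open>On one point no map fails to be injective, so \<open>g1\<close> is the only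
      extra generator forced.\<close>
    case True
    have "card (insert g1 T) \<le> card \<Gamma>" using g1 \<Gamma> by (intro card_mono) (auto simp: T_def)
    then have "card T + 1 \<le> card \<Gamma>" using g1T finT by simp
    moreover have "(if card A = 1 then 1 else 2) = (1::nat)" using True by simp
    ultimately show ?thesis using T_max by linarith
  next
    case False
    then have "\<not> card A \<le> Suc 0" using assms(5) by simp
    then obtain x y where xy: "x \<in> A" "y \<in> A" "x \<noteq> y"
      using card_le_Suc0_iff_eq[OF fin] by blast
    have "collapse A x y x = collapse A x y y" using xy by (simp add: collapse_def)
    then have "dom (collapse A x y) = A \<and> \<not> inj_on (collapse A x y) A"
      using xy by (auto simp: collapse_def inj_on_def)
    moreover have "collapse A x y \<in> PT A A" using xy by (simp add: collapse_def PT_iff)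
    ultimately obtain g2 where g2: "g2 \<in> \<Gamma>" "dom (core a g2) = A" "\<not> inj_on (core a g2) A"
      using generator_prime[OF \<Gamma>(1), where Q = "\<lambda>t. dom t = A \<and> \<not> inj_on t A"]
        total_noninjective_prime[OF fin] lift \<Gamma>(2) by (metis (lifting))
    have "g2 \<notin> T" using g2 units_total_injective(3) by (auto simp: T_def)
    moreover have "g2 \<noteq> g1" using g1T g2 by blast
    moreover have "card (insert g2 (insert g1 T)) \<le> card \<Gamma>"
      using g1 g2 \<Gamma> by (intro card_mono) (auto simp: T_def)
    ultimately have "card T + 2 \<le> card \<Gamma>" using g1T finT by simp
    moreover have "(if card A = 1 then 1 else 2) = (2::nat)" using False by simp
    ultimately show ?thesis using T_max by linarith
  qed
qed

text \<open>
  The elements with invertible core form a rectangular group. Powers of the first generator yield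
  the idempotent at position \<open>(u 0, v 0)\<close>, which cuts out that maximal subgroup; one
  generator on each side then moves it to every other position.
\<close>

lemma rectangular_group_generated:
  fixes N :: nat
  assumes "finite A" and N: "N \<ge> 1" and u: "u ` {..<N} = Ret" and v: "v ` {..<N} = Sec"
    and s: "s ` {..<N} \<subseteq> units A" "units A \<subseteq> sgp_gen (\<circ>\<^sub>m) (s ` {..<N})"
    and s0: "idp A \<in> sgp_gen (\<circ>\<^sub>m) {s 0}"
    and rtc: "r \<in> Ret" "t \<in> units A" "c \<in> Sec"
  shows "rees r t c \<in> sgp_gen (sandwich a) ((\<lambda>j. rees (u j) (s j) (v j)) ` {..<N})"
    (is "_ \<in> ?H")
proof -
  have uv: "u j \<in> Ret" "v j \<in> Sec" "s j \<in> units A" if "j < N" for j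
    using that u v s by auto
  have uv0: "u 0 \<in> Ret" "v 0 \<in> Sec" "s 0 \<in> units A" using uv[of 0] N by auto
  have prod: "rees r1 (t2 \<circ>\<^sub>m t1) c2 \<in> ?H" if "rees r1 t1 c1 \<in> ?H" "rees r2 t2 c2 \<in> ?H"
    "r1 \<in> Ret" "r2 \<in> Ret" "t1 \<in> units A" "t2 \<in> units A" "c1 \<in> Sec" "c2 \<in> Sec"
    for r1 r2 t1 t2 c1 c2
    using sgp_gen.mult[OF that(1,2)] that by (simp add: rees_mult units_PT)
  have gen: "rees (u j) (s j) (v j) \<in> ?H" if "j < N" for j
    using that by (auto intro: sgp_gen.incl)
  have pow: "rees (u 0) t (v 0) \<in> ?H" if "t \<in> sgp_gen (\<circ>\<^sub>m) B" "B \<subseteq> units A"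
    "\<And>b. b \<in> B \<Longrightarrow> rees (u 0) b (v 0) \<in> ?H" for t B
  proof -
    have B: "sgp_gen (\<circ>\<^sub>m) B \<subseteq> units A" using that(2) units_comp by (intro sgp_gen_closed)
    show ?thesis
      using that(1)
    proof induction
      case (incl x)
      then show ?case using that(3) by blast
    next
      case (mult x y)
      then have "x \<in> units A" "y \<in> units A" using B by blast+
      \<comment> \<open>The two hypotheses are swapped, since \<open>sandwich a\<close> applies its
        left factor first and \<open>\<circ>\<^sub>m\<close> its right factor.\<close>
      then show ?case using prod[OF mult.IH(2,1)] uv0 by blast
    qed
  qed
  have e: "rees (u 0) (idp A) (v 0) \<in> ?H"
    by (rule pow[OF s0]) (use uv0 gen[of 0] N in auto)
  \<comment> \<open>Multiplication by the idempotent on the left replaces the retraction by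
    \<open>u 0\<close>, on the right the section by \<open>v 0\<close>; the core is
    unchanged.\<close>
  have "rees (u 0) (s j) (v 0) \<in> ?H" if j: "j < N" for j
  proof -
    note sj = uv(3)[OF j]
    have half: "rees (u 0) (s j) (v j) \<in> ?H"
      using prod[OF e gen[OF j]] uv0 uv[OF j] idp_units[of A] idp_comp_right[OF units_PT[OF sj]] by simp
    show ?thesis
      using prod[OF half e] uv0 uv[OF j] idp_units[of A] idp_comp_left[OF units_PT[OF sj]] by simp
  qed
  then have subgroup: "rees (u 0) t (v 0) \<in> ?H" if "t \<in> units A" for t
    using pow[of t "s ` {..<N}"] s that by blast
  have "r \<in> u ` {..<N}" "c \<in> v ` {..<N}" using u v rtc by simp_all
  then obtain i j where i: "i < N" "u i = r" and j: "j < N" "v j = c" by blast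
  obtain si where si: "si \<in> units A" "si \<circ>\<^sub>m s i = idp A" using units_inverse uv(3)[OF i(1)] by metis
  obtain sj where sj: "sj \<in> units A" "s j \<circ>\<^sub>m sj = idp A" using units_inverse uv(3)[OF j(1)] by metis
  \<comment> \<open>The solution of \<open>s j \<circ>\<^sub>m (t' \<circ>\<^sub>m s i) = t\<close>,
    compensating for the cores of the outer generators.\<close>
  define t' where "t' = sj \<circ>\<^sub>m (t \<circ>\<^sub>m si)"
  have t': "t' \<in> units A" unfolding t'_def using sj si rtc by (intro units_comp)
  have "rees (u i) (t' \<circ>\<^sub>m s i) (v 0) \<in> ?H"
    using prod[OF gen[OF i(1)] subgroup[OF t']] uv[OF i(1)] uv0 t' by blast
  then have "rees (u i) (s j \<circ>\<^sub>m (t' \<circ>\<^sub>m s i)) (v j) \<in> ?H"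
    using prod[OF _ gen[OF j(1)]] uv[OF i(1)] uv[OF j(1)] uv0 units_comp[OF t'] by blast
  moreover have "s j \<circ>\<^sub>m (t' \<circ>\<^sub>m s i) = (s j \<circ>\<^sub>m sj) \<circ>\<^sub>m (t \<circ>\<^sub>m (si \<circ>\<^sub>m s i))"
    by (simp add: t'_def map_comp_assoc)
  moreover have "\<dots> = t"
    using si sj idp_comp_left[OF units_PT[OF rtc(2)]] idp_comp_right[OF units_PT[OF rtc(2)]] by simp
  ultimately show ?thesis using i j by simp
qed

text \<open>The bound is a maximum and not a sum because one generator can carry a new retraction, a
  new section and a generator of the symmetric group at once; three lists are run through in
  parallel over \<open>N\<close> indices.\<close>

lemma generating_set_exists:
  assumes fin: "finite A" "finite Ret" "finite Sec" and "card A \<ge> 1"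
    and N: "N = max (max (card Ret) (card Sec)) (if card A \<ge> 3 then 2 else 1)"
  shows "\<exists>\<Gamma>. \<Gamma> \<subseteq> P \<and> sgp_gen (sandwich a) \<Gamma> = P \<and> finite \<Gamma> \<and>
    card \<Gamma> \<le> N + (if card A = 1 then 1 else 2)"
proof -
  obtain c0 where c0: "c0 \<in> Sec" using section_exists by blast
  have ne: "Ret \<noteq> {}" "Sec \<noteq> {}" using idp_retraction c0 by blast+
  have le: "card Ret \<le> N" "card Sec \<le> N" using N by simp_all
  obtain u where u: "u ` {..<N} = Ret" using finite_surj_lessThan[OF fin(2) ne(1) le(1)] .
  obtain v where v: "v ` {..<N} = Sec" using finite_surj_lessThan[OF fin(3) ne(2) le(2)] .
  have N1: "N \<ge> 1" and N2: "card A \<ge> 3 \<Longrightarrow> N \<ge> 2" using N by (simp_all add: le_max_iff_disj)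
  obtain p q where pq: "p permutes A" "q permutes A" "card A \<le> 2 \<longrightarrow> p = q"
    "{r. r permutes A} \<subseteq> sgp_gen (\<circ>) {p, q}"
    using symmetric_two_generators[OF fin(1)] by blast
  \<comment> \<open>The second permutation needs an index beyond 0. For at least three points
    \<open>N\<close> is at least 2; for fewer points \<open>p\<close> and \<open>q\<close>
    agree.\<close>
  define s where "s j = (if j = 0 then perm_map A p else perm_map A q)" for j :: nat
  have "perm_map A q \<in> s ` {..<N}"
  proof (cases "card A \<ge> 3")
    case True
    then show ?thesis using N2 by (intro image_eqI[of _ _ 1]) (auto simp: s_def)
  next
    case False
    then have "card A \<le> 2" by simp
    then have "q = p" using pq(3) by blast
    then show ?thesis using N1 by (intro image_eqI[of _ _ 0]) (auto simp: s_def)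
  qed
  moreover have "perm_map A p \<in> s ` {..<N}"
    using N1 by (intro image_eqI[of _ _ 0]) (auto simp: s_def)
  ultimately have pqs: "perm_map A ` {p, q} \<subseteq> s ` {..<N}" by blast
  have s1: "s ` {..<N} \<subseteq> units A" using pq perm_map_units by (auto simp: s_def)
  have s2: "units A \<subseteq> sgp_gen (\<circ>\<^sub>m) (s ` {..<N})"
  proof
    fix t assume t: "t \<in> units A"
    obtain r where r: "r permutes A" "t = perm_map A r"
      using total_injective_eq_perm_map[OF fin(1) units_PT[OF t] units_total_injective(1,3)[OF t]] .
    have "t \<in> sgp_gen (\<circ>\<^sub>m) (perm_map A ` {p, q})"
      unfolding r(2) by (rule perm_map_sgp_gen) (use pq r in auto)
    then show "t \<in> sgp_gen (\<circ>\<^sub>m) (s ` {..<N})" using sgp_gen_mono[OF pqs] by blast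
  qed
  have "id \<in> sgp_gen (\<circ>) {p}"
    using permutes_sgp_gen_id_inv(1)[OF fin(1) pq(1) sgp_gen.incl] by blast
  then have s0: "idp A \<in> sgp_gen (\<circ>\<^sub>m) {s 0}"
    using perm_map_sgp_gen[of "{p}" A id] pq(1) by (simp add: s_def perm_map_id)
  define \<Gamma>0 where "\<Gamma>0 = (\<lambda>j. rees (u j) (s j) (v j)) ` {..<N}"
  have uv: "u j \<in> Ret" "v j \<in> Sec" "s j \<in> PT A A" if "j < N" for j
  proof -
    have "u j \<in> u ` {..<N}" "v j \<in> v ` {..<N}" "s j \<in> s ` {..<N}" using that by blast+
    then show "u j \<in> Ret" "v j \<in> Sec" "s j \<in> PT A A" using s1 units_PT unfolding u v by blast+
  qed
  have \<Gamma>0: "\<Gamma>0 \<subseteq> P" "card \<Gamma>0 \<le> N"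
    using uv reesI card_image_le[of "{..<N}" "\<lambda>j. rees (u j) (s j) (v j)"]
    by (auto simp: \<Gamma>0_def)
  obtain x where x: "x \<in> A" using assms(4) by fastforce
  define g1 where "g1 = rees (idp A) (idp (A - {x})) c0"
  have "idp (A - {x}) \<in> PT A A" by (simp add: PT_iff)
  then have g1: "g1 \<in> P" "core a g1 = idp (A - {x})"
    unfolding g1_def using idp_retraction c0 reesI core_rees by blast+
  have "\<exists>E. E \<subseteq> P \<and> finite E \<and> card E \<le> (if card A = 1 then 1 else 2) \<and> g1 \<in> E \<and>
    (card A \<ge> 2 \<longrightarrow> (\<exists>y\<in>A. \<exists>z\<in>A. y \<noteq> z \<and> collapse A y z \<in> core a ` E))"
  proof (cases "card A = 1")
    case True
    then show ?thesis using g1 by (intro exI[of _ "{g1}"]) auto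
  next
    case False
    then have "\<not> card A \<le> Suc 0" using assms(4) by simp
    then obtain y z where yz: "y \<in> A" "z \<in> A" "y \<noteq> z"
      using card_le_Suc0_iff_eq[OF fin(1)] by blast
    define g2 where "g2 = rees (idp A) (collapse A y z) c0"
    have "collapse A y z \<in> PT A A" using yz by (simp add: collapse_def PT_iff)
    then have g2: "g2 \<in> P" "core a g2 = collapse A y z"
      unfolding g2_def using idp_retraction c0 reesI core_rees by blast+
    have "card {g1, g2} \<le> 2" by (simp add: card_insert_if)
    then show ?thesis using False g1 g2 yz by (intro exI[of _ "{g1, g2}"]) auto
  qed
  then obtain E where E: "E \<subseteq> P" "finite E" "card E \<le> (if card A = 1 then 1 else 2)" "g1 \<in> E"
    "card A \<ge> 2 \<Longrightarrow> \<exists>y\<in>A. \<exists>z\<in>A. y \<noteq> z \<and> collapse A y z \<in> core a ` E" by blast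
  let ?\<Gamma> = "\<Gamma>0 \<union> E"
  let ?H = "sgp_gen (sandwich a) ?\<Gamma>"
  have sub: "?\<Gamma> \<subseteq> P" using \<Gamma>0 E by blast
  have HP: "?H \<subseteq> P" using generated_in_P[OF sub] by blast
  have top: "rees r t c \<in> ?H" if "r \<in> Ret" "t \<in> units A" "c \<in> Sec" for r t c
    using rectangular_group_generated[OF fin(1) N1 u v s1 s2 s0 that]
      sgp_gen_mono[of \<Gamma>0 ?\<Gamma> "sandwich a"] unfolding \<Gamma>0_def by blast
  \<comment> \<open>It is enough to generate every core first; retraction and section are adjusted
    afterwards.\<close>
  have "PT A A \<subseteq> core a ` ?H"
  proof (rule PT_generated[OF fin(1) _ _ x])
    show "units A \<subseteq> core a ` ?H"
    proof
      fix t assume t: "t \<in> units A"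
      have "core a (rees (idp A) t c0) = t" by (rule core_rees[OF idp_retraction units_PT[OF t] c0])
      then show "t \<in> core a ` ?H" using top[OF idp_retraction t c0] by (rule image_eqI[OF sym])
    qed
    show "t \<circ>\<^sub>m u \<in> core a ` ?H" if "t \<in> core a ` ?H" "u \<in> core a ` ?H" for t u
    proof -
      obtain f g where fg: "f \<in> ?H" "g \<in> ?H" "t = core a f" "u = core a g" using \<open>t \<in> _\<close> \<open>u \<in> _\<close> by blast
      then have "core a (sandwich a g f) = t \<circ>\<^sub>m u" using HP core_mult by blast
      then show ?thesis using sgp_gen.mult[OF fg(2,1)] by (rule image_eqI[OF sym])
    qed
    show "idp (A - {x}) \<in> core a ` ?H"
      using g1(2) E(4) by (intro image_eqI[of _ _ g1]) (auto intro: sgp_gen.incl)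
    show "\<exists>y\<in>A. \<exists>z\<in>A. y \<noteq> z \<and> collapse A y z \<in> core a ` ?H" if "2 \<le> card A"
      using E(5)[OF that] sgp_gen.incl[of _ ?\<Gamma> "sandwich a"] by fast
  qed
  have "P \<subseteq> ?H"
  proof
    fix f assume "f \<in> P"
    then obtain r t c where rtc: "r \<in> Ret" "t \<in> PT A A" "c \<in> Sec" "f = rees r t c"
      by (rule RegPT_cases)
    then obtain g where g: "g \<in> ?H" "core a g = t" using \<open>PT A A \<subseteq> core a ` ?H\<close> by blast
    then have "g \<in> P" using HP by blast
    then obtain r' t' c' where g': "r' \<in> Ret" "t' \<in> PT A A" "c' \<in> Sec" "g = rees r' t' c'"
      by (rule RegPT_cases)
    then have "t' = t" using core_rees[OF g'(1-3)] g(2) g'(4) by simp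
    \<comment> \<open>Factors with identity core on either side replace the outer coordinates of
      \<open>g\<close> by \<open>r\<close> and \<open>c\<close>.\<close>
    have "sandwich a (rees r (idp A) c0) (sandwich a g (rees (idp A) (idp A) c)) = f"
      using rtc g' c0 idp_retraction idp_PT[of A] \<open>t' = t\<close>
      by (simp add: rees_mult idp_comp_left[OF rtc(2)] idp_comp_right[OF rtc(2)])
    moreover have "sandwich a (rees r (idp A) c0) (sandwich a g (rees (idp A) (idp A) c)) \<in> ?H"
      using rtc c0 g idp_retraction idp_units top by (intro sgp_gen.mult) blast+
    ultimately show "f \<in> ?H" by simp
  qed
  moreover have "card ?\<Gamma> \<le> N + (if card A = 1 then 1 else 2)"
    using card_Un_le[of \<Gamma>0 E] \<Gamma>0(2) E(3) by linarith
  moreover have "finite ?\<Gamma>" using E(2) by (simp add: \<Gamma>0_def)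
  ultimately show ?thesis using sub HP by blast
qed

end

subsection \<open>Cardinalities and rank\<close>

text \<open>A retraction is free exactly on \<open>X - A\<close>, where each point goes to one of
  the points of \<open>A\<close> or is left undefined; this extra option is the summand 1.\<close>

lemma card_retractions:
  assumes "finite X" "A \<subseteq> X"
  shows "card (retractions X A) = (card A + 1) ^ card (X - A)"
proof -
  let ?F = "\<lambda>r. restrict r (X - A)"
  let ?G = "\<lambda>g x. if x \<in> A then Some x else if x \<in> X then g x else None"
  let ?C = "PiE (X - A) (\<lambda>_. insert None (Some ` A))"
  have "bij_betw ?F (retractions X A) ?C"
  proof (rule bij_betw_byWitness[where f' = ?G])
    show "\<forall>r\<in>retractions X A. ?G (?F r) = r"
    proof (intro ballI ext)
      fix r x assume "r \<in> retractions X A"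
      then show "?G (?F r) x = r x"
        using assms(2) by (cases "r x") (auto simp: retractions_iff PT_iff)
    qed
    show "\<forall>g\<in>?C. ?F (?G g) = g"
      using assms(2) by (auto simp: fun_eq_iff restrict_def PiE_def extensional_def)
    show "?F ` retractions X A \<subseteq> ?C"
    proof (intro image_subsetI restrict_PiE_iff[THEN iffD2] ballI)
      fix r x assume "r \<in> retractions X A" "x \<in> X - A"
      then show "r x \<in> insert None (Some ` A)"
        using assms(2) by (cases "r x") (auto simp: retractions_iff PT_iff)
    qed
    show "?G ` ?C \<subseteq> retractions X A"
    proof (rule image_subsetI)
      fix g assume g: "g \<in> ?C"
      have "y \<in> A" if "x \<in> X" "x \<notin> A" "g x = Some y" for x y
        using PiE_mem[OF g, of x] that by auto
      then show "?G g \<in> retractions X A"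
        using assms(2) by (auto simp: retractions_iff PT_iff split: if_splits)
    qed
  qed
  then have "card (retractions X A) = card ?C" by (rule bij_betw_same_card)
  also have "\<dots> = (\<Prod>x\<in>X - A. card (insert None (Some ` A)))"
    using assms by (intro card_PiE) auto
  also have "card (insert None (Some ` A)) = card A + 1"
    using finite_subset[OF assms(2,1)] by (subst card_insert_disjoint) (auto simp: card_image)
  finally show ?thesis by simp
qed

text \<open>A section is an independent choice of one preimage for each point of the range.\<close>

lemma card_sections:
  assumes "finite (ran a)"
  shows "card (sections a) = (\<Prod>p\<in>ran a. card (a -` {Some p}))"
proof -
  let ?F = "\<lambda>c. restrict (\<lambda>p. the (c p)) (ran a)"
  let ?G = "\<lambda>g p. if p \<in> ran a then Some (g p) else None"
  let ?C = "PiE (ran a) (\<lambda>p. a -` {Some p})"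
  have "bij_betw ?F (sections a) ?C"
  proof (rule bij_betw_byWitness[where f' = ?G])
    show "\<forall>c\<in>sections a. ?G (?F c) = c"
    proof (intro ballI ext)
      fix c p assume c: "c \<in> sections a"
      show "?G (?F c) p = c p"
      proof (cases "p \<in> ran a")
        case True
        then obtain y where "c p = Some y" using c by (auto simp: sections_iff)
        then show ?thesis using True by simp
      next
        case False
        then have "p \<notin> dom c" using c unfolding sections_iff by blast
        then show ?thesis using False by (simp add: domIff)
      qed
    qed
    show "\<forall>g\<in>?C. ?F (?G g) = g"
      by (auto simp: fun_eq_iff restrict_def PiE_def extensional_def)
    show "?F ` sections a \<subseteq> ?C"
    proof (intro image_subsetI restrict_PiE_iff[THEN iffD2] ballI)
      fix c p assume "c \<in> sections a" "p \<in> ran a"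
      then obtain y where "c p = Some y" "a y = Some p" unfolding sections_iff by blast
      then show "the (c p) \<in> a -` {Some p}" by simp
    qed
    show "?G ` ?C \<subseteq> sections a"
      by (auto simp: sections_iff PiE_iff split: if_splits)
  qed
  then have "card (sections a) = card ?C" by (rule bij_betw_same_card)
  then show ?thesis using card_PiE[OF assms] by simp
qed

text \<open>The choice in \<open>sgp_rank\<close> is harmless, since any two least cardinals lie
  below each other.\<close>

lemma sgp_rank_eqI:
  assumes "\<Gamma> \<in> generating_sets S m" "\<And>\<Gamma>'. \<Gamma>' \<in> generating_sets S m \<Longrightarrow> |\<Gamma>| \<le>o |\<Gamma>'|"
  shows "sgp_rank S m =o |\<Gamma>|"
proof -
  let ?Q = "\<lambda>r. r \<in> card_of ` generating_sets S m \<and> (\<forall>r' \<in> card_of ` generating_sets S m. r \<le>o r')"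
  have "?Q |\<Gamma>|" using assms by blast
  then have "?Q (sgp_rank S m)" unfolding sgp_rank_def by (rule someI)
  then obtain \<Gamma>' where "\<Gamma>' \<in> generating_sets S m" "sgp_rank S m = |\<Gamma>'|" by blast
  then have "|\<Gamma>| \<le>o sgp_rank S m" using assms(2) by simp
  moreover have "sgp_rank S m \<le>o |\<Gamma>|" using \<open>?Q (sgp_rank S m)\<close> assms(1) by blast
  ultimately show ?thesis using ordIso_iff_ordLeq by blast
qed

lemma finite_card_of_le_infinite:
  assumes "finite A" "infinite B"
  shows "|A| \<le>o |B|"
  using ordLeq_total[OF card_of_Well_order card_of_Well_order, of A B]
    card_of_ordLeq_finite[of B A] assms by blast

text \<open>Infinite generating sets exceed a finite one anyway, so only finite competitors need
  counting.\<close>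

lemma sgp_rank_eq_natI:
  assumes "\<Gamma> \<in> generating_sets S m" "finite \<Gamma>" "card \<Gamma> \<le> n"
    and "\<And>\<Gamma>'. \<Gamma>' \<in> generating_sets S m \<Longrightarrow> finite \<Gamma>' \<Longrightarrow> n \<le> card \<Gamma>'"
  shows "sgp_rank S m =o |{..<n}|"
proof -
  have n: "card \<Gamma> = n" using assms by (simp add: le_antisym)
  have "|\<Gamma>| \<le>o |\<Gamma>'|" if "\<Gamma>' \<in> generating_sets S m" for \<Gamma>'
  proof (cases "finite \<Gamma>'")
    case True
    then have "\<exists>f. f ` \<Gamma> \<subseteq> \<Gamma>' \<and> inj_on f \<Gamma>"
      using assms(2,4) that n by (intro card_le_inj) auto
    then show ?thesis using card_of_ordLeq[of \<Gamma> \<Gamma>'] by blast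
  next
    case False
    then show ?thesis using assms(2) finite_card_of_le_infinite by blast
  qed
  then have "sgp_rank S m =o |\<Gamma>|" using assms(1) sgp_rank_eqI by blast
  moreover have "|\<Gamma>| =o |{..<n}|"
    using finite_same_card_bij[of \<Gamma> "{..<n}"] assms(2) n card_of_ordIso[of \<Gamma> "{..<n}"] by auto
  ultimately show ?thesis by (rule ordIso_transitive)
qed

text \<open>The generated semigroup is exhausted by countably many levels \<open>L n\<close>, each
  adding the products of pairs from the one before; none of them outgrows the infinite
  bound.\<close>

lemma card_of_sgp_gen:
  assumes B: "infinite B" and A: "|A| \<le>o |B|"
  shows "|sgp_gen m A| \<le>o |B|"
proof -
  define F where "F S = S \<union> (\<lambda>(x, y). m x y) ` (S \<times> S)" for S
  define L where "L n = (F ^^ n) A" for n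
  have L: "L 0 = A" "L (Suc n) = L n \<union> (\<lambda>(x, y). m x y) ` (L n \<times> L n)" for n
    by (simp_all add: L_def F_def)
  have mono: "L i \<subseteq> L j" if "i \<le> j" for i j
    using that by (rule lift_Suc_mono_le[rotated]) (auto simp: L)
  have "sgp_gen m A \<subseteq> (\<Union>n. L n)"
  proof (rule sgp_gen_closed)
    show "A \<subseteq> (\<Union>n. L n)" using L(1) by blast
    show "m x y \<in> (\<Union>n. L n)" if xy: "x \<in> (\<Union>n. L n)" "y \<in> (\<Union>n. L n)" for x y
    proof -
      obtain i j where "x \<in> L i" "y \<in> L j" using xy by blast
      then have "x \<in> L (max i j)" "y \<in> L (max i j)" 
        using mono[of i "max i j"] mono[of j "max i j"] by auto
      then have "m x y \<in> L (Suc (max i j))" by (auto simp: L)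
      then show ?thesis by blast
    qed
  qed
  moreover have "|L n| \<le>o |B|" for n
  proof (induction n)
    case 0
    then show ?case using A L by simp
  next
    case (Suc n)
    have "|L n \<times> L n| \<le>o |B|"
      using Suc B
      by (intro card_of_Times_ordLeq_infinite_Field) (simp_all add: Field_card_of card_of_card_order_on)
    then have "|(\<lambda>(x, y). m x y) ` (L n \<times> L n)| \<le>o |B|"
      using card_of_image ordLeq_transitive by blast
    then show ?case
      unfolding L using Suc B
      by (intro card_of_Un_ordLeq_infinite_Field) (simp_all add: Field_card_of card_of_card_order_on)
  qed
  then have "|\<Union>n. L n| \<le>o |B|"
    using B infinite_iff_card_of_nat by (intro card_of_UNION_ordLeq_infinite) auto
  ultimately show ?thesis using card_of_mono1 ordLeq_transitive by blast
qed

section \<open>The rank in the infinite, finite and trivial cases\<close>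

context sandwich_PT
begin

lemma P_eq_image: "P = (\<lambda>(r, t, c). rees r t c) ` (Ret \<times> PT A A \<times> Sec)"
  unfolding RegPT_eq_rees by force

text \<open>Partial identities occur as cores. Hence \<open>P\<close> has at least as many elements
  as \<open>A\<close> has subsets, which makes \<open>A\<close> finite when \<open>P\<close> is, and
  \<open>P\<close> uncountable when \<open>A\<close> is infinite.\<close>

lemma Pow_subset_cores: "Pow A \<subseteq> (\<lambda>f. dom (core a f)) ` P"
proof
  fix D assume D: "D \<in> Pow A"
  obtain c0 where c0: "c0 \<in> Sec" using section_exists by blast
  have "idp D \<in> PT A A" using D by (auto simp: PT_iff)
  then have "rees (idp A) (idp D) c0 \<in> P" "core a (rees (idp A) (idp D) c0) = idp D"
    using c0 idp_retraction reesI core_rees by blast+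
  then show "D \<in> (\<lambda>f. dom (core a f)) ` P" by (intro image_eqI) simp_all
qed

text \<open>With the core fixed as \<open>idp A\<close>, retractions and sections embed in
  \<open>P\<close>.\<close>

lemma finite_coordinates:
  assumes "finite P"
  shows "finite Ret" and "finite Sec" and "finite A"
proof -
  obtain c0 where c0: "c0 \<in> Sec" using section_exists by blast
  have "inj_on (\<lambda>r. rees r (idp A) c0) Ret"
    using rees_inject(1)[OF _ idp_units c0 _ idp_PT c0] by (rule inj_onI)
  moreover have "(\<lambda>r. rees r (idp A) c0) ` Ret \<subseteq> P" using reesI idp_PT c0 by blast
  ultimately show "finite Ret" using assms inj_on_finite by blast
  have "inj_on (\<lambda>c. rees (idp A) (idp A) c) Sec"
    using rees_inject(3)[OF idp_retraction idp_units _ idp_retraction idp_PT] by (rule inj_onI)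
  moreover have "(\<lambda>c. rees (idp A) (idp A) c) ` Sec \<subseteq> P" using reesI idp_PT idp_retraction by blast
  ultimately show "finite Sec" using assms inj_on_finite by blast
  have "finite (Pow A)" using finite_subset[OF Pow_subset_cores] assms by blast
  then show "finite A" by simp
qed

text \<open>Each point of \<open>X - A\<close> gives its own retraction, defined only there and on
  \<open>A\<close>; each preimage of \<open>p\<close> gives its own section, by changing a fixed one
  at \<open>p\<close>.\<close>

lemma finite_fibres:
  assumes "finite P" "A \<noteq> {}"
  shows "finite X" and "p \<in> A \<Longrightarrow> finite (a -` {Some p})"
proof -
  obtain q where q: "q \<in> A" using assms(2) by blast
  let ?r = "\<lambda>b. (idp A)(b \<mapsto> q)"
  have "?r ` (X - A) \<subseteq> Ret" using q A_subset by (auto simp: retractions_iff PT_iff)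
  moreover have "inj_on ?r (X - A)"
  proof (rule inj_onI)
    fix b d assume "b \<in> X - A" "d \<in> X - A" "?r b = ?r d"
    then show "b = d" by (auto dest: fun_cong[of _ _ b] split: if_splits)
  qed
  ultimately have "finite (X - A)" using finite_coordinates(1)[OF assms(1)] inj_on_finite by blast
  then show "finite X" using finite_coordinates(3)[OF assms(1)] A_subset finite_Diff2 by blast
  show "finite (a -` {Some p})" if "p \<in> A"
  proof -
    obtain c0 where c0: "c0 \<in> Sec" using section_exists by blast
    have "(\<lambda>y. c0(p \<mapsto> y)) ` (a -` {Some p}) \<subseteq> Sec"
      using c0 that by (auto simp: sections_iff)
    moreover have "inj_on (\<lambda>y. c0(p \<mapsto> y)) (a -` {Some p})"
      by (rule inj_onI) (metis fun_upd_same option.inject)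
    ultimately show ?thesis using finite_coordinates(2)[OF assms(1)] inj_on_finite by blast
  qed
qed

lemma generating_sets_iff:
  "\<Gamma> \<in> generating_sets P (sandwich a) \<longleftrightarrow> \<Gamma> \<subseteq> P \<and> sgp_gen (sandwich a) \<Gamma> = P"
  by (simp add: generating_sets_def)

lemma P_generating: "P \<in> generating_sets P (sandwich a)"
  unfolding generating_sets_iff
proof (intro conjI equalityI subsetI)
  show "f \<in> P" if "f \<in> sgp_gen (sandwich a) P" for f by (rule generated_in_P[OF order_refl that])
qed (auto intro: sgp_gen.incl)

lemma infinite_generating_set:
  assumes "infinite P" "\<Gamma> \<in> generating_sets P (sandwich a)"
  shows "infinite \<Gamma>"
proof
  assume fin: "finite \<Gamma>"
  have \<Gamma>: "\<Gamma> \<subseteq> P" "sgp_gen (sandwich a) \<Gamma> = P"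
    using assms(2) unfolding generating_sets_iff by blast+
  show False
  proof (cases "finite A")
    case True
    have "finite {f \<in> \<Gamma>. core a f \<in> units A}" using fin by simp
    then have "finite Ret" "finite Sec"
      using generator_unit_surjections[OF True \<Gamma>] by (blast intro: finite_surj)+
    then have "finite P" unfolding P_eq_image using finite_PT[OF True True] by blast
    then show False using assms(1) by blast
  next
    case False
    \<comment> \<open>Finitely many generators yield a countable semigroup, while \<open>P\<close>
      is at least as large as the power set of the infinite set \<open>A\<close>; this contradicts
      Cantor's theorem.\<close>
    have "|\<Gamma>| \<le>o |UNIV :: nat set|"
      using fin finite_card_of_le_infinite infinite_UNIV_nat by blast
    then have "|P| \<le>o |UNIV :: nat set|"
      using card_of_sgp_gen[of "UNIV :: nat set" \<Gamma> "sandwich a"] \<Gamma>(2) by simp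
    moreover have "|UNIV :: nat set| \<le>o |A|" using False infinite_iff_card_of_nat by blast
    moreover have "|Pow A| \<le>o |P|" using Pow_subset_cores surj_imp_ordLeq by blast
    ultimately have "|Pow A| \<le>o |A|" by (meson ordLeq_transitive)
    then show False using card_of_Pow not_ordLess_ordLeq by blast
  qed
qed

lemma rank_infinite:
  assumes "infinite P"
  shows "sgp_rank P (sandwich a) =o |P|"
proof (rule sgp_rank_eqI[OF P_generating])
  fix \<Gamma> assume \<Gamma>: "\<Gamma> \<in> generating_sets P (sandwich a)"
  then have "|sgp_gen (sandwich a) \<Gamma>| \<le>o |\<Gamma>|"
    using infinite_generating_set[OF assms] card_of_sgp_gen card_of_refl ordIso_imp_ordLeq by blast
  then show "|P| \<le>o |\<Gamma>|" using \<Gamma> unfolding generating_sets_iff by simp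
qed

lemma rank_finite:
  assumes "finite P" "A \<noteq> {}"
  shows "sgp_rank P (sandwich a) =o |{..<max (max (card Ret) (card Sec)) (if card A \<ge> 3 then 2 else 1)
    + (if card A = 1 then 1 else 2)}|"
proof -
  note fin = finite_coordinates[OF assms(1)]
  have A: "card A \<ge> 1" using fin(3) assms(2) by (simp add: Suc_leI card_gt_0_iff)
  obtain \<Gamma> where "\<Gamma> \<subseteq> P" "sgp_gen (sandwich a) \<Gamma> = P" "finite \<Gamma>"
    "card \<Gamma> \<le> max (max (card Ret) (card Sec)) (if card A \<ge> 3 then 2 else 1)
      + (if card A = 1 then 1 else 2)"
    using generating_set_exists[OF fin(3,1,2) A refl] by blast
  then show ?thesis
    using generating_set_card_ge[OF fin(3) _ _ _ A]
    by (intro sgp_rank_eq_natI) (simp_all only: generating_sets_iff)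
qed

text \<open>Only the empty map remains, and as a semigroup it is not generated by the empty set, so
  the rank is 1 and not 0.\<close>

lemma rank_trivial:
  assumes "A = {}"
  shows "sgp_rank P (sandwich a) =o |{..<1::nat}|"
proof -
  have "Map.empty \<in> P" by (auto simp: RegPT_def PT_def sandwich_def)
  moreover have "f = Map.empty" if "f \<in> P" for f
    using that by (rule RegPT_cases) (auto simp: rees_def sections_def assms)
  ultimately have P: "P = {Map.empty}" by blast
  show ?thesis
  proof (rule sgp_rank_eq_natI[OF P_generating])
    fix \<Gamma> assume \<Gamma>: "\<Gamma> \<in> generating_sets P (sandwich a)" "finite \<Gamma>"
    have "\<Gamma> \<noteq> {}"
    proof
      assume "\<Gamma> = {}"
      then have "P \<subseteq> {}" using \<Gamma>(1) sgp_gen_closed[of \<Gamma> "{}" "sandwich a"]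
        unfolding generating_sets_iff by blast
      then show False using P by blast
    qed
    then show "1 \<le> card \<Gamma>" using \<Gamma>(2) by (simp add: Suc_leI card_gt_0_iff)
  qed (simp_all add: P)
qed

end

theorem theorem2p42:
  fixes X :: "'x set" and Y :: "'y set" and a :: "'y \<rightharpoonup> 'x"
    and I :: "'i set" and ai :: "'i \<Rightarrow> 'x"
    and lam :: "'i \<Rightarrow> nat" and Lam \<alpha> \<beta> :: nat and P :: "('x \<rightharpoonup> 'y) set"
  assumes "a \<in> PT Y X"
    and "inj_on ai I" and "ran a = ai ` I"
  defines "lam \<equiv> \<lambda>i. card (a -` {Some (ai i)})"
    and "Lam \<equiv> \<Prod>i\<in>I. lam i"
    and "\<alpha> \<equiv> card (ran a)"
    and "\<beta> \<equiv> card (X - ran a)"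
    and "P \<equiv> RegPT X Y a"
  shows "(infinite P \<longrightarrow> sgp_rank P (sandwich a) =o |P| ) \<and>
    (finite P \<longrightarrow>
      (ran a = {} \<or> (finite X \<and> (\<forall>i\<in>I. finite (a -` {Some (ai i)})))) \<and>
      sgp_rank P (sandwich a) =o
        |{..< if \<alpha> = 0 then 1
              else if \<alpha> = 1 then 1 + max (2 ^ \<beta>) Lam
              else if \<alpha> = 2 then 2 + max (3 ^ \<beta>) Lam
              else 2 + max (max ((\<alpha> + 1) ^ \<beta>) Lam) 2}| )"
proof -
  interpret sandwich_PT X Y a by unfold_locales (rule assms(1))
  let ?n = "if \<alpha> = 0 then 1
              else if \<alpha> = 1 then 1 + max (2 ^ \<beta>) Lam
              else if \<alpha> = 2 then 2 + max (3 ^ \<beta>) Lam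
              else 2 + max (max ((\<alpha> + 1) ^ \<beta>) Lam) 2"
  have "sgp_rank P (sandwich a) =o |P|" if "infinite P"
    using rank_infinite that by (simp add: P_def)
  moreover have "ran a = {} \<or> (finite X \<and> (\<forall>i\<in>I. finite (a -` {Some (ai i)})))" if "finite P"
  proof (cases "ran a = {}")
    case False
    then show ?thesis using finite_fibres that assms(3) by (simp add: P_def)
  qed simp
  moreover have "sgp_rank P (sandwich a) =o |{..<?n}|" if "finite P"
  proof (cases "ran a = {}")
    case True
    then have "?n = 1" by (simp add: \<alpha>_def)
    then show ?thesis using rank_trivial[OF True] by (simp only: P_def)
  next
    case False
    have finP: "finite (RegPT X Y a)" using that by (simp add: P_def)
    note fin = finite_coordinates(3)[OF finP] finite_fibres(1)[OF finP False]
    have "\<alpha> \<noteq> 0" using False fin by (simp add: \<alpha>_def)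
    have R: "card (retractions X (ran a)) = (\<alpha> + 1) ^ \<beta>"
      unfolding \<alpha>_def \<beta>_def by (rule card_retractions[OF fin(2) A_subset])
    \<comment> \<open>Injectivity of \<open>ai\<close> turns the product over \<open>ran a\<close>
      into the product over \<open>I\<close>.\<close>
    have S: "card (sections a) = Lam"
      unfolding card_sections[OF fin(1)] Lam_def lam_def assms(3)
      by (simp add: prod.reindex[OF assms(2)])
    \<comment> \<open>For \<alpha> below 3 the third entry of the maximum is 1, absorbed by the
      number of retractions.\<close>
    have mx: "max (max ((\<alpha> + 1) ^ \<beta>) Lam) 1 = max ((\<alpha> + 1) ^ \<beta>) Lam"
      by (rule max_absorb1) (simp add: le_max_iff_disj)
    have "?n = max (max ((\<alpha> + 1) ^ \<beta>) Lam) (if \<alpha> \<ge> 3 then 2 else 1) + (if \<alpha> = 1 then 1 else 2)"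
    proof -
      consider "\<alpha> = 1" | "\<alpha> = 2" | "\<alpha> \<ge> 3" using \<open>\<alpha> \<noteq> 0\<close> by linarith
      then show ?thesis
      proof cases
        case 1
        then have "\<alpha> + 1 = 2" by simp
        from mx[unfolded this] show ?thesis unfolding \<open>\<alpha> + 1 = 2\<close> using 1 by simp
      next
        case 2
        then have "\<alpha> + 1 = 3" by simp
        from mx[unfolded this] show ?thesis unfolding \<open>\<alpha> + 1 = 3\<close> using 2 by simp
      next
        case 3
        then show ?thesis by simp
      qed
    qed
    then show ?thesis
      using rank_finite[OF finP False] unfolding R S P_def \<alpha>_def[symmetric] by simp
  qed
  ultimately show ?thesis by blast
qed

end
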